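(* Let $B_C=(b_0,\ldots,b_{r-1})$ and $B_R=(b'_0,\ldots,b'_{t-1})$ be two tuples of integers such that $b_0=t$, $b'_0=r$, and $\Delta B_C$ and $\Delta B_R$ are both partitions of $s$ (trailing zeros allowed). Then there is a set $\mathbb{X}$ of $s$ distinct points in $\mathbb{P}^1\times\mathbb{P}^1$ such that $B_C$ is the eventual column vector and $B_R$ is the eventual row vector of the Hilbert function of $\mathbb{X}$ if and only if $\Delta B_C\unrhd(\Delta B_R)^*$.
   Context: $\mathbf{k}$ is an algebraically closed field of characteristic zero, $\mathbb{N}=\{0,1,2,\ldots\}$, and $\mathbb{P}^1$ is the projective line over $\mathbf{k}$. $R=\mathbf{k}[x_0,x_1,y_0,y_1]$ is bigraded by $\deg x_i=(1,0)$, $\deg y_i=(0,1)$. For a finite set $\mathbb{X}\subseteq\mathbb{P}^1\times\mathbb{P}^1$, $I_{\mathbb{X}}\subseteq R$ is the (bihomogeneous) ideal of all polynomials vanishing at every point of $\mathbb{X}$, and its Hilbert function is $H_{\mathbb{X}}(i,j)=\dim_{\mathbf{k}}(R/I_{\mathbb{X}})_{(i,j)}$ for $(i,j)\in\mathbb{N}^2$. Let $\pi_1,\pi_2$ be the projections of $\mathbb{P}^1\times\mathbb{P}^1$ onto the first and second factor. Eventual vectors: if $t=|\pi_1(\mathbb{X})|$ and $r=|\pi_2(\mathbb{X})|$, the eventual column vector of $H_{\mathbb{X}}$ is $(H_{\mathbb{X}}(t-1,0),H_{\mathbb{X}}(t-1,1),\ldots,H_{\mathbb{X}}(t-1,r-1))$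 (a tuple of length $r$) and the eventual row vector is $(H_{\mathbb{X}}(0,r-1),H_{\mathbb{X}}(1,r-1),\ldots,H_{\mathbb{X}}(t-1,r-1))$ (a tuple of length $t$). For a tuple $p=(p_1,\ldots,p_m)$, $\Delta p:=(p_1,p_2-p_1,\ldots,p_m-p_{m-1})$. A partition $\lambda=(\lambda_1,\ldots,\lambda_m)$ of $s$ is a non-increasing tuple of non-negative integers with sum $s$ (trailing zeros are permitted here and are ignored when comparing partitions). Its conjugate is $\lambda^*=(\lambda_1^*,\ldots,\lambda^*_{\lambda_1})$ with $\lambda_i^*=\#\{j:\lambda_j\ge i\}$. For two partitions $\lambda,\delta$ of $s$, padded by zeros to a common length, $\lambda\unrhd\delta$ ($\lambda$ majorizes $\delta$) means $\lambda_1+\cdots+\lambda_i\ge\delta_1+\cdots+\delta_i$ for all $i$. *)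

theory Defs
  imports
    "HOL-Computational_Algebra.Polynomial"
    "HOL-Algebra.QuotRing"
    "HOL-Algebra.Embedded_Algebras"
    "HOL-Library.Poly_Mapping"
begin

definition proj_rel :: "(('k::field \<times> 'k) \<times> ('k \<times> 'k)) set" where
  "proj_rel = {(u, v). u \<noteq> (0, 0) \<and> v \<noteq> (0, 0) \<and>
                 (\<exists>c. c \<noteq> 0 \<and> fst v = c * fst u \<and> snd v = c * snd u)}"

text \<open>A point is the set of all its homogeneous coordinate vectors.\<close>

definition proj_line :: "('k::field \<times> 'k) set set" where
  "proj_line = (UNIV - {(0, 0)}) // proj_rel"

type_synonym 'k point = "('k \<times> 'k) set \<times> ('k \<times> 'k) set"

datatype var = X0 | X1 | Y0 | Y1

text \<open>
  Monomials are exponent vectors; the multiplication which \<^theory>\<open>HOL-Library.Poly_Mapping\<close>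
  puts on \<open>(var \<Rightarrow>\<^sub>0 nat) \<Rightarrow>\<^sub>0 'k\<close> is convolution, that is, multiplication of polynomials.
\<close>

type_synonym 'k bipoly = "(var \<Rightarrow>\<^sub>0 nat) \<Rightarrow>\<^sub>0 'k"

definition bipoly_ring :: "'k::field bipoly ring" where
  "bipoly_ring = \<lparr>carrier = UNIV, mult = (*), one = 1, zero = 0, add = (+)\<rparr>"

definition eval_bipoly :: "'k::field bipoly \<Rightarrow> (var \<Rightarrow> 'k) \<Rightarrow> 'k" where
  "eval_bipoly f a =
     (\<Sum>m\<in>Poly_Mapping.keys f.
        Poly_Mapping.lookup f m * (\<Prod>v\<in>{X0, X1, Y0, Y1}. a v ^ Poly_Mapping.lookup m v))"

fun coords :: "'k \<times> 'k \<Rightarrow> 'k \<times> 'k \<Rightarrow> var \<Rightarrow> 'k" where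
  "coords p q X0 = fst p"
| "coords p q X1 = snd p"
| "coords p q Y0 = fst q"
| "coords p q Y1 = snd q"

text \<open>The \<open>(i, j)\<close>-graded piece, zero polynomial included.\<close>

definition bihom_piece :: "nat \<Rightarrow> nat \<Rightarrow> 'k::field bipoly set" where
  "bihom_piece i j =
     {f. \<forall>m\<in>Poly_Mapping.keys f.
        Poly_Mapping.lookup m X0 + Poly_Mapping.lookup m X1 = i \<and>
        Poly_Mapping.lookup m Y0 + Poly_Mapping.lookup m Y1 = j}"

text \<open>
  A polynomial that need not be bihomogeneous vanishes at a point if it vanishes at all
  choices of homogeneous coordinates; this makes the ideal bihomogeneous.
\<close>

definition vanishing_ideal :: "'k::field point set \<Rightarrow> 'k bipoly set" where
  "vanishing_ideal X =
     {f. \<forall>(P, Q)\<in>X. \<forall>p\<in>P. \<forall>q\<in>Q. eval_bipoly f (coords p q) = 0}"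

definition coord_ring :: "'k::field point set \<Rightarrow> 'k bipoly set ring" where
  "coord_ring X = bipoly_ring Quot vanishing_ideal X"

text \<open>
  \<^const>\<open>ring.dim\<close> measures dimension over a subfield of the ambient ring, so the ground field
  enters as the image of the constant polynomials in the quotient (a copy of it unless \<open>X\<close> is
  empty).
\<close>

definition coord_ring_scalars :: "'k::field point set \<Rightarrow> 'k bipoly set set" where
  "coord_ring_scalars X =
     (\<lambda>c. vanishing_ideal X +>\<^bsub>bipoly_ring\<^esub> Poly_Mapping.single 0 c) ` UNIV"

definition coord_ring_piece :: "'k::field point set \<Rightarrow> nat \<Rightarrow> nat \<Rightarrow> 'k bipoly set set" where
  "coord_ring_piece X i j =
     (\<lambda>f. vanishing_ideal X +>\<^bsub>bipoly_ring\<^esub> f) ` bihom_piece i j"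

definition hilbert_fun :: "'k::field point set \<Rightarrow> nat \<Rightarrow> nat \<Rightarrow> nat" where
  "hilbert_fun X i j = ring.dim (coord_ring X) (coord_ring_scalars X) (coord_ring_piece X i j)"

definition eventual_column :: "'k::field point set \<Rightarrow> int list" where
  "eventual_column X =
     map (\<lambda>j. int (hilbert_fun X (card (fst ` X) - 1) j)) [0..<card (snd ` X)]"

definition eventual_row :: "'k::field point set \<Rightarrow> int list" where
  "eventual_row X =
     map (\<lambda>i. int (hilbert_fun X i (card (snd ` X) - 1))) [0..<card (fst ` X)]"

definition diff_tuple :: "int list \<Rightarrow> int list" where
  "diff_tuple p = map (\<lambda>i. if i = 0 then p ! 0 else p ! i - p ! (i - 1)) [0..<length p]"

definition is_partition :: "int list \<Rightarrow> nat \<Rightarrow> bool" where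
  "is_partition p s \<longleftrightarrow>
     sorted_wrt (\<ge>) p \<and> (\<forall>x\<in>set p. 0 \<le> x) \<and> sum_list p = int s"

definition conjugate :: "int list \<Rightarrow> int list" where
  "conjugate p =
     map (\<lambda>i. int (card {j. j < length p \<and> i \<le> p ! j})) (if p = [] then [] else [1..p ! 0])"

text \<open>
  \<open>take n\<close> returns the whole list once \<open>n\<close> exceeds its length, so these partial sums are those of
  the tuples padded by zeros.
\<close>

definition majorizes :: "int list \<Rightarrow> int list \<Rightarrow> bool"  (infix \<open>\<unrhd>\<close> 50) where
  "p \<unrhd> q \<longleftrightarrow> (\<forall>n. sum_list (take n q) \<le> sum_list (take n p))"

end

theory Submission
  imports Defs
begin

text \<open>
  Let \<open>\<alpha>\<close> and \<open>\<beta>\<close> list the numbers of points of \<open>X\<close> in the fibres of the two projections. Forms of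
  degree \<open>t - 1\<close> in the first factor separate the \<open>t\<close> fibres, and \<open>\<alpha>\<^sub>P\<close> points on a line impose
  \<open>min \<alpha>\<^sub>P (j + 1)\<close> independent conditions on binary forms of degree \<open>j\<close>; hence the
  difference of the eventual column vector is the conjugate of \<open>\<alpha>\<close>, and likewise for rows and
  \<open>\<beta>\<close>. So \<open>X\<close> exists iff there is a 0-1 matrix with prescribed row and column sums, and the
  criterion is the Gale-Ryser theorem. Its existence part starts from a Ferrers diagram with the right
  row sums and moves points between columns, within rows, until the column sums agree.
\<close>

section \<open>Evaluation of bihomogeneous polynomials\<close>

text \<open>Factoring the monomials out of evaluation leaves it linear in the coefficients, with all
  multiplicativity carried by \<open>monomial_value\<close>.\<close>

definition monomial_value :: "(var \<Rightarrow>\<^sub>0 nat) \<Rightarrow> (var \<Rightarrow> 'k::field) \<Rightarrow> 'k" where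
  "monomial_value m a = (\<Prod>v\<in>{X0, X1, Y0, Y1}. a v ^ Poly_Mapping.lookup m v)"

lemma monomial_value_0 [simp]: "monomial_value 0 a = 1"
  by (simp add: monomial_value_def)

lemma monomial_value_add: "monomial_value (m + n) a = monomial_value m a * monomial_value n a"
  by (simp add: monomial_value_def lookup_add power_add)

lemma monomial_value_coords:
  "monomial_value m (coords p q) =
     fst p ^ Poly_Mapping.lookup m X0 * snd p ^ Poly_Mapping.lookup m X1 *
     (fst q ^ Poly_Mapping.lookup m Y0 * snd q ^ Poly_Mapping.lookup m Y1)"
  by (simp add: monomial_value_def mult.assoc)

lemma eval_bipoly_monomials:
  "eval_bipoly f a = (\<Sum>m\<in>Poly_Mapping.keys f. Poly_Mapping.lookup f m * monomial_value m a)"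
  by (simp add: eval_bipoly_def monomial_value_def)

lemma eval_bipoly_0 [simp]: "eval_bipoly 0 a = 0"
  by (simp add: eval_bipoly_def)

lemma eval_bipoly_single [simp]:
  "eval_bipoly (Poly_Mapping.single m c) a = c * monomial_value m a"
  by (simp add: eval_bipoly_monomials)

lemma eval_bipoly_add [simp]: "eval_bipoly (f + g) a = eval_bipoly f a + eval_bipoly g a"
  unfolding eval_bipoly_monomials
  \<comment> \<open>Cancellation can shrink the key set of \<open>f + g\<close>, so the three sums
    range over different sets.\<close>
  by (rule setsum_keys_plus_distrib[where f = "\<lambda>m c. c * monomial_value m a"])
    (simp_all add: algebra_simps)

lemma eval_bipoly_sum: "eval_bipoly (sum f A) a = (\<Sum>x\<in>A. eval_bipoly (f x) a)"
  by (induction A rule: infinite_finite_induct) simp_all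

lemma eval_bipoly_uminus [simp]: "eval_bipoly (- f) a = - eval_bipoly f a"
  using eval_bipoly_add[of f "- f" a] by (simp add: eq_neg_iff_add_eq_0 add.commute)

lemma eval_bipoly_diff [simp]: "eval_bipoly (f - g) a = eval_bipoly f a - eval_bipoly g a"
  using eval_bipoly_add[of f "- g" a] by simp

lemma bipoly_sum_monomials:
  fixes f :: "'k::field bipoly"
  shows "f = (\<Sum>m\<in>Poly_Mapping.keys f. Poly_Mapping.single m (Poly_Mapping.lookup f m))"
proof (rule poly_mapping_eqI)
  fix m
  have "(\<Sum>n\<in>Poly_Mapping.keys f. Poly_Mapping.lookup
          (Poly_Mapping.single n (Poly_Mapping.lookup f n)) m) =
        (\<Sum>n\<in>Poly_Mapping.keys f. if n = m then Poly_Mapping.lookup f m else 0)"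
    by (intro sum.cong) (auto simp: lookup_single when_def)
  then show "Poly_Mapping.lookup f m = Poly_Mapping.lookup
      (\<Sum>m\<in>Poly_Mapping.keys f. Poly_Mapping.single m (Poly_Mapping.lookup f m)) m"
    by (simp add: lookup_sum in_keys_iff)
qed

text \<open>Cancellation makes the keys of a product hard to describe. Expanding both factors into
  monomials and evaluating termwise avoids them.\<close>

lemma eval_bipoly_mult [simp]: "eval_bipoly (f * g) a = eval_bipoly f a * eval_bipoly g a"
proof -
  have "f * g = (\<Sum>m\<in>Poly_Mapping.keys f. \<Sum>n\<in>Poly_Mapping.keys g.
      Poly_Mapping.single (m + n) (Poly_Mapping.lookup f m * Poly_Mapping.lookup g n))"
    by (subst bipoly_sum_monomials[of f], subst bipoly_sum_monomials[of g])
      (simp add: sum_product mult_single)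
  then have "eval_bipoly (f * g) a = (\<Sum>m\<in>Poly_Mapping.keys f. \<Sum>n\<in>Poly_Mapping.keys g.
      (Poly_Mapping.lookup f m * monomial_value m a) *
      (Poly_Mapping.lookup g n * monomial_value n a))"
    by (simp add: eval_bipoly_sum monomial_value_add algebra_simps)
  then show ?thesis
    by (simp add: eval_bipoly_monomials sum_product)
qed

section \<open>Bigraded pieces and their restriction to fibres\<close>

lemma bihom_piece_0 [simp]: "0 \<in> bihom_piece i j"
  by (simp add: bihom_piece_def)

lemma bihom_piece_add: "\<lbrakk>f \<in> bihom_piece i j; g \<in> bihom_piece i j\<rbrakk> \<Longrightarrow> f + g \<in> bihom_piece i j"
  using keys_add[of f g] unfolding bihom_piece_def by blast

lemma bihom_piece_uminus: "f \<in> bihom_piece i j \<Longrightarrow> - f \<in> bihom_piece i j"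
  by (simp add: bihom_piece_def)

lemma bihom_piece_diff: "\<lbrakk>f \<in> bihom_piece i j; g \<in> bihom_piece i j\<rbrakk> \<Longrightarrow> f - g \<in> bihom_piece i j"
  using bihom_piece_add[of f i j "- g"] bihom_piece_uminus[of g] by simp

lemma bihom_piece_mult:
  assumes "f \<in> bihom_piece i j" "g \<in> bihom_piece i' j'"
  shows "f * g \<in> bihom_piece (i + i') (j + j')"
  unfolding bihom_piece_def
proof (intro CollectI ballI)
  fix m assume "m \<in> Poly_Mapping.keys (f * g)"
  then obtain a b where "m = a + b" "a \<in> Poly_Mapping.keys f" "b \<in> Poly_Mapping.keys g"
    using keys_mult[of f g] by blast
  with assms show "Poly_Mapping.lookup m X0 + Poly_Mapping.lookup m X1 = i + i' \<and>
        Poly_Mapping.lookup m Y0 + Poly_Mapping.lookup m Y1 = j + j'"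
    by (auto simp: bihom_piece_def lookup_add)
qed

lemma bihom_piece_const [simp]: "Poly_Mapping.single 0 c \<in> bihom_piece 0 0"
  by (auto simp: bihom_piece_def)

lemma bihom_piece_smult:
  "f \<in> bihom_piece i j \<Longrightarrow> Poly_Mapping.single 0 c * f \<in> bihom_piece i j"
  using bihom_piece_mult[OF bihom_piece_const, of f i j c] by simp

text \<open>Rescaling coordinates multiplies every monomial of a form by the same factor, so one
  coordinate vector per point is enough to test vanishing.\<close>

lemma eval_bipoly_homogeneous:
  assumes "f \<in> bihom_piece i j"
  shows "eval_bipoly f (coords (c * fst p, c * snd p) (d * fst q, d * snd q)) =
         c ^ i * d ^ j * eval_bipoly f (coords p q)"
proof -
  have "monomial_value m (coords (c * fst p, c * snd p) (d * fst q, d * snd q)) =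
        c ^ i * d ^ j * monomial_value m (coords p q)" if "m \<in> Poly_Mapping.keys f" for m
  proof -
    have "i = Poly_Mapping.lookup m X0 + Poly_Mapping.lookup m X1"
      "j = Poly_Mapping.lookup m Y0 + Poly_Mapping.lookup m Y1"
      using assms that by (auto simp: bihom_piece_def)
    then show ?thesis
      by (simp add: monomial_value_coords power_add power_mult_distrib)
  qed
  then show ?thesis
    by (simp add: eval_bipoly_monomials sum_distrib_left mult.left_commute cong: sum.cong)
qed

text \<open>Once one point is fixed, the monomials are grouped by a single exponent of the other
  factor, because the bidegree forces the remaining exponent.\<close>

lemma eval_bipoly_binary_form:
  assumes "f \<in> bihom_piece i j"
  shows "\<exists>c. \<forall>q. eval_bipoly f (coords p q) = (\<Sum>l\<le>j. c l * fst q ^ l * snd q ^ (j - l))"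
    and "\<exists>c. \<forall>p. eval_bipoly f (coords p q) = (\<Sum>l\<le>i. c l * fst p ^ l * snd p ^ (i - l))"
proof -
  let ?c = "\<lambda>l. \<Sum>m\<in>{m \<in> Poly_Mapping.keys f. Poly_Mapping.lookup m Y0 = l}.
      Poly_Mapping.lookup f m * (fst p ^ Poly_Mapping.lookup m X0 * snd p ^ Poly_Mapping.lookup m X1)"
  have "eval_bipoly f (coords p q) = (\<Sum>l\<le>j. ?c l * fst q ^ l * snd q ^ (j - l))" for q
  proof -
    have "(\<Sum>l\<le>j. ?c l * fst q ^ l * snd q ^ (j - l)) =
       (\<Sum>l\<le>j. \<Sum>m\<in>{m \<in> Poly_Mapping.keys f. Poly_Mapping.lookup m Y0 = l}.
          Poly_Mapping.lookup f m * monomial_value m (coords p q))"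
      using assms unfolding bihom_piece_def sum_distrib_right
      by (intro sum.cong) (auto simp: monomial_value_coords algebra_simps)
    also have "\<dots> = eval_bipoly f (coords p q)"
      unfolding eval_bipoly_monomials using assms
      by (intro sum.group) (auto simp: bihom_piece_def)
    finally show ?thesis by simp
  qed
  then show "\<exists>c. \<forall>q. eval_bipoly f (coords p q) = (\<Sum>l\<le>j. c l * fst q ^ l * snd q ^ (j - l))"
    by (intro exI[of _ ?c] allI)
  let ?d = "\<lambda>l. \<Sum>m\<in>{m \<in> Poly_Mapping.keys f. Poly_Mapping.lookup m X0 = l}.
      Poly_Mapping.lookup f m * (fst q ^ Poly_Mapping.lookup m Y0 * snd q ^ Poly_Mapping.lookup m Y1)"
  have "eval_bipoly f (coords p q) = (\<Sum>l\<le>i. ?d l * fst p ^ l * snd p ^ (i - l))" for p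
  proof -
    have "(\<Sum>l\<le>i. ?d l * fst p ^ l * snd p ^ (i - l)) =
       (\<Sum>l\<le>i. \<Sum>m\<in>{m \<in> Poly_Mapping.keys f. Poly_Mapping.lookup m X0 = l}.
          Poly_Mapping.lookup f m * monomial_value m (coords p q))"
      using assms unfolding bihom_piece_def sum_distrib_right
      by (intro sum.cong) (auto simp: monomial_value_coords algebra_simps)
    also have "\<dots> = eval_bipoly f (coords p q)"
      unfolding eval_bipoly_monomials using assms
      by (intro sum.group) (auto simp: bihom_piece_def)
    finally show ?thesis by simp
  qed
  then show "\<exists>c. \<forall>p. eval_bipoly f (coords p q) = (\<Sum>l\<le>i. c l * fst p ^ l * snd p ^ (i - l))"
    by (intro exI[of _ ?d] allI)
qed

text \<open>Dehomogenising loses at most the point at infinity, where the second coordinate is 0.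
  Vanishing there kills the top coefficient, so the root bound drops together with the number of
  roots.\<close>

lemma binary_form_eq_0:
  fixes c :: "nat \<Rightarrow> 'k::field"
  assumes "finite Z" and card: "n < card Z"
    and zero: "\<And>u. u \<in> Z \<Longrightarrow> (\<Sum>l\<le>n. c l * fst u ^ l * snd u ^ (n - l)) = 0"
    and indep: "\<And>u v. \<lbrakk>u \<in> Z; v \<in> Z; u \<noteq> v\<rbrakk> \<Longrightarrow> fst u * snd v \<noteq> snd u * fst v"
    and nz: "(0, 0) \<notin> Z"
  shows "l \<le> n \<Longrightarrow> c l = 0"
proof -
  define P where "P = (\<Sum>l\<le>n. Polynomial.monom (c l) l)"
  have coeff_P: "Polynomial.coeff P l = (if l \<le> n then c l else 0)" for l
    by (simp add: P_def coeff_sum)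
  define A where "A = {u \<in> Z. snd u \<noteq> 0}"
  have finA: "finite A" using \<open>finite Z\<close> by (simp add: A_def)
  have root: "poly P (fst u / snd u) = 0" if "u \<in> A" for u
  proof -
    have "snd u ^ n * poly P (fst u / snd u) =
          (\<Sum>l\<le>n. c l * fst u ^ l * snd u ^ (n - l))"
      unfolding P_def poly_sum poly_monom sum_distrib_left
    proof (intro sum.cong refl)
      fix l assume "l \<in> {..n}"
      then have "snd u ^ n = snd u ^ l * snd u ^ (n - l)" by (simp flip: power_add)
      then show "snd u ^ n * (c l * (fst u / snd u) ^ l) = c l * fst u ^ l * snd u ^ (n - l)"
        using that by (simp add: A_def power_divide)
    qed
    then show ?thesis using that zero[of u] by (simp add: A_def)
  qed
  have inj: "inj_on (\<lambda>u. fst u / snd u) A"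
  proof (rule inj_onI, rule ccontr)
    fix u v assume "u \<in> A" "v \<in> A" "fst u / snd u = fst v / snd v" "u \<noteq> v"
    then show False using indep[of u v] by (auto simp: A_def field_simps)
  qed
  have "P = 0"
  proof (rule ccontr)
    assume "P \<noteq> 0"
    have "card A = card ((\<lambda>u. fst u / snd u) ` A)"
      using inj by (simp add: card_image)
    also have "\<dots> \<le> card {z. poly P z = 0}"
      using root poly_roots_finite[OF \<open>P \<noteq> 0\<close>] by (intro card_mono) auto
    also have "\<dots> \<le> Polynomial.degree P"
      by (rule card_poly_roots_bound[OF \<open>P \<noteq> 0\<close>])
    finally have A_le: "card A \<le> Polynomial.degree P" .
    have deg: "Polynomial.degree P \<le> n" by (intro degree_le) (simp add: coeff_P)
    \<comment> \<open>Without a point at infinity \<open>A\<close> is all of \<open>Z\<close>, and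
      its more than \<open>n\<close> roots already contradict the degree bound.\<close>
    obtain u where u: "u \<in> Z" "snd u = 0"
      using A_le deg card by (cases "A = Z") (auto simp: A_def)
    then have fu: "fst u \<noteq> 0" using nz by (cases u) auto
    have "Z - A \<subseteq> {u}"
      using u indep[of _ u] by (fastforce simp: A_def)
    then have "card Z \<le> card (insert u A)"
      using finA by (intro card_mono) auto
    with finA have "card Z \<le> Suc (card A)"
      by (simp add: card_insert_if split: if_splits)
    with A_le deg card have "Polynomial.degree P = n" by simp
    \<comment> \<open>At infinity only the term \<open>l = n\<close> survives, so vanishing there is
      vanishing of the top coefficient.\<close>
    have "c n * fst u ^ n = (\<Sum>l\<le>n. c l * fst u ^ l * snd u ^ (n - l))"
      using u by (subst sum.remove[of _ n]) (auto intro!: sum.neutral)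
    then have "c n = 0" using zero[OF u(1)] fu by simp
    then show False
      using \<open>P \<noteq> 0\<close> \<open>Polynomial.degree P = n\<close> coeff_P[of n] by (metis leading_coeff_0_iff order_refl)
  qed
  then show "l \<le> n \<Longrightarrow> c l = 0" using coeff_P[of l] by simp
qed

section \<open>Points and their coordinates\<close>

lemma equiv_proj_rel: "equiv (UNIV - {(0, 0)}) (proj_rel :: (('k::field \<times> 'k) \<times> _) set)"
proof (rule equivI)
  show "proj_rel \<subseteq> (UNIV - {(0, 0)}) \<times> (UNIV - {(0::'k, 0::'k)})"
    by (auto simp: proj_rel_def)
  show "refl_on (UNIV - {(0, 0)}) (proj_rel :: (('k \<times> 'k) \<times> _) set)"
    by (auto simp: refl_on_def proj_rel_def intro!: exI[of _ 1])
  show "sym (proj_rel :: (('k \<times> 'k) \<times> _) set)"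
  proof (rule symI)
    fix u v :: "'k \<times> 'k" assume "(u, v) \<in> proj_rel"
    then obtain c where "u \<noteq> (0, 0)" "v \<noteq> (0, 0)" "c \<noteq> 0" "fst v = c * fst u" "snd v = c * snd u"
      by (auto simp: proj_rel_def)
    then show "(v, u) \<in> proj_rel"
      by (auto simp: proj_rel_def intro!: exI[of _ "inverse c"])
  qed
  show "trans (proj_rel :: (('k \<times> 'k) \<times> _) set)"
  proof (rule transI)
    fix u v w :: "'k \<times> 'k" assume "(u, v) \<in> proj_rel" "(v, w) \<in> proj_rel"
    then obtain c d where "u \<noteq> (0, 0)" "w \<noteq> (0, 0)" "c \<noteq> 0" "fst v = c * fst u" "snd v = c * snd u"
      "d \<noteq> 0" "fst w = d * fst v" "snd w = d * snd v"
      by (auto simp: proj_rel_def)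
    then show "(u, w) \<in> proj_rel"
      by (auto simp: proj_rel_def intro!: exI[of _ "d * c"])
  qed
qed

definition proj_rep :: "('k::field \<times> 'k) set \<Rightarrow> 'k \<times> 'k" where
  "proj_rep P = (SOME p. p \<in> P)"

lemma proj_rep_in:
  assumes "P \<in> proj_line" shows "proj_rep P \<in> P"
  using in_quotient_imp_non_empty[OF equiv_proj_rel assms[unfolded proj_line_def]]
  unfolding proj_rep_def by (simp add: some_in_eq)

lemma proj_rep_nonzero:
  assumes "P \<in> proj_line" shows "proj_rep P \<noteq> (0, 0)"
  using in_quotient_imp_subset[OF equiv_proj_rel assms[unfolded proj_line_def]] proj_rep_in[OF assms]
  by blast

lemma proj_line_scaled:
  assumes "P \<in> proj_line" "p \<in> P"
  obtains c where "p = (c * fst (proj_rep P), c * snd (proj_rep P))"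
proof -
  have "(proj_rep P, p) \<in> proj_rel"
    using in_quotient_imp_in_rel[OF equiv_proj_rel assms(1)[unfolded proj_line_def]]
      proj_rep_in[OF assms(1)] assms(2) by blast
  then show thesis using that by (auto simp: proj_rel_def prod_eq_iff)
qed

text \<open>Two nonzero plane vectors with zero determinant are proportional. This turns
  distinctness of points into the algebraic condition used both for counting zeros and for building
  separating forms.\<close>

lemma proj_rep_independent:
  assumes "P \<in> proj_line" "Q \<in> proj_line" "P \<noteq> Q"
  shows "fst (proj_rep P) * snd (proj_rep Q) \<noteq> snd (proj_rep P) * fst (proj_rep Q)"
proof
  assume eq: "fst (proj_rep P) * snd (proj_rep Q) = snd (proj_rep P) * fst (proj_rep Q)"
  obtain a b where ab: "proj_rep P = (a, b)" by force
  obtain c d where cd: "proj_rep Q = (c, d)" by force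
  have nz: "(a, b) \<noteq> (0, 0)" "(c, d) \<noteq> (0, 0)"
    using proj_rep_nonzero assms ab cd by metis+
  have "((a, b), (c, d)) \<in> proj_rel"
  proof (cases "a = 0")
    case True
    with nz eq ab cd have "b \<noteq> 0" "c = 0" by auto
    with True nz show ?thesis
      \<comment> \<open>The scaling factor is read off from a coordinate that does not vanish: the
        second one here, the first one in the other case.\<close>
      by (auto simp: proj_rel_def intro!: exI[of _ "d / b"])
  next
    case False
    with nz eq ab cd have "c \<noteq> 0" by (auto simp: field_simps)
    with False nz eq ab cd show ?thesis
      by (auto simp: proj_rel_def field_simps intro!: exI[of _ "c / a"])
  qed
  then have "P = Q"
    using quotient_eqI[OF equiv_proj_rel, of P Q "(a, b)" "(c, d)"] assms proj_rep_in[of P]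
      proj_rep_in[of Q] ab cd unfolding proj_line_def by auto
  with assms show False by simp
qed

text \<open>Fixing coordinates makes evaluation at a point a linear functional; on a form, its being
  zero does not depend on the choice.\<close>

definition eval_at :: "'k::field bipoly \<Rightarrow> 'k point \<Rightarrow> 'k" where
  "eval_at f x = eval_bipoly f (coords (proj_rep (fst x)) (proj_rep (snd x)))"

lemma eval_at_simps [simp]:
  "eval_at 0 x = 0"
  "eval_at (f + g) x = eval_at f x + eval_at g x"
  "eval_at (f - g) x = eval_at f x - eval_at g x"
  "eval_at (f * g) x = eval_at f x * eval_at g x"
  "eval_at (Poly_Mapping.single 0 c) x = c"
  by (simp_all add: eval_at_def)

lemma vanishing_ideal_eval_at:
  assumes "X \<subseteq> proj_line \<times> proj_line" "f \<in> vanishing_ideal X" "x \<in> X"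
  shows "eval_at f x = 0"
  using assms proj_rep_in[of "fst x"] proj_rep_in[of "snd x"]
  by (fastforce simp: vanishing_ideal_def eval_at_def)

lemma bihom_piece_vanishing_ideal:
  assumes X: "X \<subseteq> proj_line \<times> proj_line" and f: "f \<in> bihom_piece i j"
    and zero: "\<And>x. x \<in> X \<Longrightarrow> eval_at f x = 0"
  shows "f \<in> vanishing_ideal X"
  unfolding vanishing_ideal_def
proof safe
  fix P Q p0 p1 q0 q1 assume PQ: "(P, Q) \<in> X" "(p0, p1) \<in> P" "(q0, q1) \<in> Q"
  with X have "P \<in> proj_line" "Q \<in> proj_line" by auto
  obtain c where c: "(p0, p1) = (c * fst (proj_rep P), c * snd (proj_rep P))"
    using proj_line_scaled[OF \<open>P \<in> proj_line\<close> PQ(2)] .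
  obtain d where d: "(q0, q1) = (d * fst (proj_rep Q), d * snd (proj_rep Q))"
    using proj_line_scaled[OF \<open>Q \<in> proj_line\<close> PQ(3)] .
  show "eval_bipoly f (coords (p0, p1) (q0, q1)) = 0"
    unfolding c d eval_bipoly_homogeneous[OF f]
    using zero[OF PQ(1)] by (simp add: eval_at_def)
qed

section \<open>The Hilbert function as a number of separated points\<close>

lemma ring_bipoly_ring: "ring (bipoly_ring :: 'k::field bipoly ring)"
  by (rule ringI[OF abelian_groupI monoidI])
    (auto simp: bipoly_ring_def algebra_simps intro: exI[of _ "- x" for x])

lemma bipoly_ring_simps [simp]:
  "carrier bipoly_ring = UNIV" "\<one>\<^bsub>bipoly_ring\<^esub> = 1" "\<zero>\<^bsub>bipoly_ring\<^esub> = 0"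
  "x \<oplus>\<^bsub>bipoly_ring\<^esub> y = x + y" "x \<otimes>\<^bsub>bipoly_ring\<^esub> y = x * y"
  by (simp_all add: bipoly_ring_def)

lemma bipoly_ring_a_inv [simp]: "\<ominus>\<^bsub>bipoly_ring\<^esub> f = - (f :: 'k::field bipoly)"
proof -
  interpret ring "bipoly_ring :: 'k bipoly ring" by (rule ring_bipoly_ring)
  show ?thesis using minus_equality[of "- f" f] by simp
qed

lemma vanishing_ideal_iff:
  "f \<in> vanishing_ideal X \<longleftrightarrow>
     (\<forall>P Q p q. (P, Q) \<in> X \<longrightarrow> p \<in> P \<longrightarrow> q \<in> Q \<longrightarrow> eval_bipoly f (coords p q) = 0)"
  by (auto simp: vanishing_ideal_def)

lemma ideal_vanishing_ideal: "ideal (vanishing_ideal (X :: 'k::field point set)) bipoly_ring"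
proof (rule idealI[OF ring_bipoly_ring])
  interpret ring "bipoly_ring :: 'k bipoly ring" by (rule ring_bipoly_ring)
  show "subgroup (vanishing_ideal X) (add_monoid bipoly_ring)"
    by (rule add.subgroupI)
      (auto simp: vanishing_ideal_iff a_inv_def[symmetric] ex_in_conv[symmetric]
        intro: exI[of _ 0])
qed (auto simp: vanishing_ideal_iff)

text \<open>Carried along the quotient map, this field becomes the scalars over which the Hilbert
  function measures dimension.\<close>

lemma subfield_constants:
  "subfield (Poly_Mapping.single 0 ` UNIV :: 'k::field bipoly set) bipoly_ring"
proof -
  interpret ring "bipoly_ring :: 'k bipoly ring" by (rule ring_bipoly_ring)
  have "subcring (Poly_Mapping.single 0 ` UNIV :: 'k bipoly set) bipoly_ring"
    by (intro subcringI subringI)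
      (auto simp: single_uminus[symmetric] single_add[symmetric] mult_single mult.commute
        image_iff intro: exI[of _ 1])
  then show ?thesis
  proof (rule subfieldI)
    let ?K = "Poly_Mapping.single 0 ` UNIV :: 'k bipoly set"
    show "Units (bipoly_ring\<lparr>carrier := ?K\<rparr>) = ?K - {\<zero>\<^bsub>bipoly_ring\<^esub>}"
    proof (intro equalityI subsetI)
      fix f assume "f \<in> ?K - {\<zero>\<^bsub>bipoly_ring\<^esub>}"
      then obtain c where "f = Poly_Mapping.single 0 c" "c \<noteq> 0"
        by (metis DiffD1 DiffD2 bipoly_ring_simps(3) image_iff insertI1 single_zero)
      then show "f \<in> Units (bipoly_ring\<lparr>carrier := ?K\<rparr>)"
        by (auto simp: Units_def mult_single bipoly_ring_def
            intro!: exI[of _ "inverse c"])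
    qed (auto simp: Units_def bipoly_ring_def)
  qed
qed

text \<open>Evaluation at the points of \<open>S\<close> is injective on the graded piece modulo the
  ideal, since \<open>S\<close> determines all values on \<open>X\<close>, and it is onto, since the
  points of \<open>S\<close> can be separated. The dimension is therefore the number of points of
  \<open>S\<close>, without a description of the ideal.\<close>

lemma hilbert_fun_eq_card:
  fixes X :: "'k::field point set"
  assumes X: "X \<subseteq> proj_line \<times> proj_line" "X \<noteq> {}" and S: "S \<subseteq> X" "finite S"
    and determined: "\<And>f x. \<lbrakk>f \<in> bihom_piece i j; \<And>y. y \<in> S \<Longrightarrow> eval_at f y = 0; x \<in> X\<rbrakk>
      \<Longrightarrow> eval_at f x = 0"
    and separated: "\<And>x. x \<in> S \<Longrightarrow>
      \<exists>f\<in>bihom_piece i j. eval_at f x \<noteq> 0 \<and> (\<forall>y\<in>S - {x}. eval_at f y = 0)"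
  shows "hilbert_fun X i j = card S"
proof -
  let ?I = "vanishing_ideal X" and ?R = "bipoly_ring :: 'k bipoly ring"
  define \<phi> where "\<phi> f = ?I +>\<^bsub>?R\<^esub> f" for f
  interpret I: ideal ?I ?R by (rule ideal_vanishing_ideal)
  interpret \<phi>: ring_hom_ring ?R "coord_ring X" \<phi>
    using I.rcos_ring_hom_ring unfolding coord_ring_def \<phi>_def[abs_def] .
  have \<phi>_eq: "\<phi> f = \<phi> g \<longleftrightarrow> f - g \<in> ?I" for f g
  proof -
    have "\<phi> f = \<phi> g \<longleftrightarrow> f \<in> ?I +>\<^bsub>?R\<^esub> g"
      using I.a_rcos_self[of f] I.a_repr_independence[of f ?I g] I.a_subgroup
      unfolding \<phi>_def by (auto simp: additive_subgroup_def I.is_additive_subgroup)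
    also have "\<dots> \<longleftrightarrow> f - g \<in> ?I"
      by (auto simp: a_r_coset_def' algebra_simps intro: bexI[of _ "f - g"])
    finally show ?thesis .
  qed
  have eval_cong: "eval_at f x = eval_at g x" if "\<phi> f = \<phi> g" "x \<in> X" for f g x
    using vanishing_ideal_eval_at[OF X(1), of "f - g" x] that by (simp add: \<phi>_eq)
  obtain x0 where x0: "x0 \<in> X" using X by blast
  let ?K = "coord_ring_scalars X"
  have K: "?K = \<phi> ` Poly_Mapping.single 0 ` UNIV"
    by (auto simp: coord_ring_scalars_def \<phi>_def)
  \<comment> \<open>A point of \<open>X\<close> keeps 1 out of the ideal; in a zero quotient the
    constants would not be a field.\<close>
  have "\<phi> 1 \<noteq> \<phi> 0"
    using eval_cong[OF _ x0, of 1 0] by (auto simp: eval_at_def simp flip: single_one)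
  then have "\<one>\<^bsub>coord_ring X\<^esub> \<noteq> \<zero>\<^bsub>coord_ring X\<^esub>"
    using \<phi>.hom_one \<phi>.hom_zero by simp
  then have sub: "subfield ?K (coord_ring X)"
    using \<phi>.img_is_subfield(2)[OF subfield_constants] by (simp add: K)
  \<comment> \<open>Classes of forms supported, within \<open>S\<close>, on \<open>T\<close>. They
    grow from zero at \<open>T = {}\<close> to the whole piece at \<open>T = S\<close>, and each new
    point contributes one dimension.\<close>
  define E where "E T = \<phi> ` {f \<in> bihom_piece i j. \<forall>y\<in>S - T. eval_at f y = 0}" for T
  have "\<phi>.S.dimension (card T) ?K (E T)" if "T \<subseteq> S" for T
    using finite_subset[OF that S(2)] that
  proof (induction T rule: finite_induct)
    case empty
    have "E {} = {\<zero>\<^bsub>coord_ring X\<^esub>}"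
    proof (intro equalityI subsetI)
      fix v assume "v \<in> E {}"
      then obtain f where f: "v = \<phi> f" "f \<in> bihom_piece i j" "\<forall>y\<in>S. eval_at f y = 0"
        by (auto simp: E_def)
      then have "f \<in> ?I" using bihom_piece_vanishing_ideal[OF X(1)] determined by blast
      then have "\<phi> f = \<phi> 0" by (simp add: \<phi>_eq)
      with f show "v \<in> {\<zero>\<^bsub>coord_ring X\<^esub>}" using \<phi>.hom_zero by simp
    next
      fix v assume "v \<in> {\<zero>\<^bsub>coord_ring X\<^esub>}"
      then have "v = \<phi> 0" using \<phi>.hom_zero by simp
      then show "v \<in> E {}" by (auto simp: E_def)
    qed
    then show ?case using \<phi>.S.dimension.zero_dim by simp
  next
    case (insert x T)
    obtain g where g: "g \<in> bihom_piece i j" "eval_at g x \<noteq> 0" "\<forall>y\<in>S - {x}. eval_at g y = 0"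
      using separated[of x] insert.prems by auto
    have "\<phi> g \<notin> E T"
    proof
      assume "\<phi> g \<in> E T"
      then obtain f where "\<phi> g = \<phi> f" "\<forall>y\<in>S - T. eval_at f y = 0" by (auto simp: E_def)
      then show False using eval_cong[of g f x] g insert S(1) by auto
    qed
    moreover have "\<phi>.S.line_extension ?K (\<phi> g) (E T) = E (insert x T)"
    proof (intro equalityI subsetI)
      fix v assume "v \<in> \<phi>.S.line_extension ?K (\<phi> g) (E T)"
      then obtain c f where "v = \<phi> (Poly_Mapping.single 0 c) \<otimes>\<^bsub>coord_ring X\<^esub> \<phi> g \<oplus>\<^bsub>coord_ring X\<^esub> \<phi> f"
        "f \<in> bihom_piece i j" "\<forall>y\<in>S - T. eval_at f y = 0"
        unfolding \<phi>.S.line_extension_def K E_def set_add_def' r_coset_def by auto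
      moreover from this have "v = \<phi> (Poly_Mapping.single 0 c * g + f)"
        using \<phi>.hom_mult[of "Poly_Mapping.single 0 c" g]
          \<phi>.hom_add[of "Poly_Mapping.single 0 c * g" f] by simp
      ultimately show "v \<in> E (insert x T)"
        using g unfolding E_def
        by (intro image_eqI[of v \<phi> "Poly_Mapping.single 0 c * g + f"])
          (auto intro!: bihom_piece_add bihom_piece_smult)
    next
      fix v assume "v \<in> E (insert x T)"
      then obtain f where f: "v = \<phi> f" "f \<in> bihom_piece i j"
        "\<forall>y\<in>S - insert x T. eval_at f y = 0"
        by (auto simp: E_def)
      \<comment> \<open>This multiple of the separating form \<open>g\<close> removes the value of
        \<open>f\<close> at \<open>x\<close> and leaves its values on the rest of \<open>S\<close>
        unchanged.\<close>
      let ?c = "Poly_Mapping.single 0 (eval_at f x / eval_at g x)"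
      have "eval_at (f - ?c * g) y = 0" if "y \<in> S - T" for y
        using f g that by (cases "y = x") simp_all
      moreover have "f - ?c * g \<in> bihom_piece i j"
        using f g by (intro bihom_piece_diff bihom_piece_smult)
      ultimately have "\<phi> (f - ?c * g) \<in> E T" by (auto simp: E_def)
      moreover have "v = \<phi> ?c \<otimes>\<^bsub>coord_ring X\<^esub> \<phi> g \<oplus>\<^bsub>coord_ring X\<^esub> \<phi> (f - ?c * g)"
        using f(1) \<phi>.hom_mult[of ?c g] \<phi>.hom_add[of "?c * g" "f - ?c * g"] by simp
      ultimately show "v \<in> \<phi>.S.line_extension ?K (\<phi> g) (E T)"
        unfolding \<phi>.S.line_extension_def K set_add_def' r_coset_def by blast
    qed
    moreover have "\<phi> g \<in> carrier (coord_ring X)" using \<phi>.hom_closed[of g] by simp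
    ultimately show ?case
      using \<phi>.S.dimension.Suc_dim[of "\<phi> g" "E T" "card T" ?K] insert by simp
  qed
  from this[of S] have "\<phi>.S.dimension (card S) ?K (coord_ring_piece X i j)"
    by (simp add: E_def coord_ring_piece_def \<phi>_def)
  then show ?thesis
    using \<phi>.S.dimI[OF sub] by (simp add: hilbert_fun_def over_def)
qed

section \<open>The Gale-Ryser theorem\<close>

text \<open>Double counting of the pairs \<open>(a, i)\<close> with \<open>i < n\<close> and
  \<open>i < d a\<close>: the first \<open>n\<close> columns of a Ferrers diagram, counted by rows
  and by columns. Every passage to a conjugate rests on this identity.\<close>

lemma sum_min_eq_sum_card:
  fixes d :: "'a \<Rightarrow> nat"
  assumes "finite A"
  shows "(\<Sum>a\<in>A. min (d a) n) = (\<Sum>i<n. card {a\<in>A. i < d a})"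
proof -
  have "(\<Sum>a\<in>A. min (d a) n) = (\<Sum>a\<in>A. card {i\<in>{..<n}. i < d a})"
  proof (intro sum.cong refl)
    fix a
    have "{i\<in>{..<n}. i < d a} = {..<min (d a) n}" by auto
    then show "min (d a) n = card {i\<in>{..<n}. i < d a}" by simp
  qed
  also have "\<dots> = (\<Sum>i<n. card {a\<in>A. i < d a})"
    using assms by (intro sum_multicount_gen) auto
  finally show ?thesis .
qed

lemma exists_top_subset:
  fixes d :: "'a \<Rightarrow> nat"
  assumes "finite A" "n \<le> card A"
  shows "\<exists>T\<subseteq>A. card T = n \<and> (\<forall>x\<in>T. \<forall>y\<in>A - T. d y \<le> d x)"
  using assms(2)
proof (induction n)
  case 0
  show ?case by (intro exI[of _ "{}"]) auto
next
  case (Suc n)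
  then obtain T where T: "T \<subseteq> A" "card T = n" "\<forall>x\<in>T. \<forall>y\<in>A - T. d y \<le> d x" by auto
  have "finite (A - T)" "A - T \<noteq> {}"
    using T Suc.prems assms(1) by (auto dest: card_mono[rotated])
  then obtain z where z: "z \<in> A - T" "\<forall>y\<in>A - T. d y \<le> d z"
    using Max_in[of "d ` (A - T)"] Max_ge[of "d ` (A - T)"] by fastforce
  have "finite T" using T assms(1) finite_subset by blast
  with T z show ?case by (intro exI[of _ "insert z T"]) auto
qed

text \<open>A row meets \<open>n\<close> columns in at most \<open>n\<close> points and in no more
  than it has, so this bounds the number of points in the \<open>n\<close> fullest columns. The left
  side expresses their sizes, cut off at height \<open>m\<close>, through conjugate counts, because
  the columns carry no order.\<close>

lemma gale_ryser_necessary: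
  fixes X :: "('a \<times> 'b) set"
  assumes X: "finite X" "X \<subseteq> A \<times> B" "finite A" "finite B"
  shows "(\<Sum>j<m. min (card {b\<in>B. j < card {a. (a, b) \<in> X}}) n)
           \<le> (\<Sum>a\<in>A. min (card {b. (a, b) \<in> X}) n)"
proof -
  let ?d = "\<lambda>b. card {a. (a, b) \<in> X}"
  \<comment> \<open>With fewer than \<open>n\<close> columns, all of them are taken.\<close>
  define n' where "n' = min n (card B)"
  obtain T where T: "T \<subseteq> B" "card T = n'" "\<forall>x\<in>T. \<forall>y\<in>B - T. ?d y \<le> ?d x"
    using exists_top_subset[OF X(4), of n' ?d] by (auto simp: n'_def)
  have finT: "finite T" using T X(4) finite_subset by blast
  have "min (card {b\<in>B. j < ?d b}) n \<le> card {b\<in>T. j < ?d b}" for j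
  \<comment> \<open>Either all chosen columns are higher than \<open>j\<close>, or one is not; in
    the latter case no column outside \<open>T\<close> is, by the choice of
    \<open>T\<close>.\<close>
  proof (cases "T \<subseteq> {b\<in>B. j < ?d b}")
    case True
    then have eq: "{b\<in>T. j < ?d b} = T" by blast
    have "card {b\<in>B. j < ?d b} \<le> card B" using X(4) by (intro card_mono) auto
    then show ?thesis unfolding eq T(2) n'_def by simp
  next
    case False
    then obtain x where x: "x \<in> T" "\<not> j < ?d x" using T(1) by blast
    have "{b\<in>B. j < ?d b} \<subseteq> {b\<in>T. j < ?d b}"
    proof safe
      fix b assume "b \<in> B" "j < ?d b"
      then show "b \<in> T" using T(3) x by (meson DiffI le_trans not_le)
    qed
    then have "card {b\<in>B. j < ?d b} \<le> card {b\<in>T. j < ?d b}"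
      using finT by (intro card_mono) auto
    then show ?thesis by simp
  qed
  then have "(\<Sum>j<m. min (card {b\<in>B. j < ?d b}) n) \<le> (\<Sum>j<m. card {b\<in>T. j < ?d b})"
    by (intro sum_mono)
  also have "\<dots> = (\<Sum>b\<in>T. min (?d b) m)"
    by (rule sum_min_eq_sum_card[OF finT, symmetric])
  also have "\<dots> \<le> (\<Sum>b\<in>T. ?d b)"
    by (intro sum_mono) simp
  also have "\<dots> = (\<Sum>b\<in>T. card {a\<in>A. (a, b) \<in> X})"
    using X(2) by (intro sum.cong refl arg_cong[of _ _ card]) auto
  also have "\<dots> = (\<Sum>a\<in>A. card {b\<in>T. (a, b) \<in> X})"
    using finT X(3) by (intro sum_multicount_gen) auto
  also have "\<dots> \<le> (\<Sum>a\<in>A. min (card {b. (a, b) \<in> X}) n)"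
  proof (rule sum_mono)
    fix a
    have "{b. (a, b) \<in> X} \<subseteq> B" using X(2) by auto
    then have "finite {b. (a, b) \<in> X}" using X(4) finite_subset by blast
    then have "card {b\<in>T. (a, b) \<in> X} \<le> card {b. (a, b) \<in> X}" by (intro card_mono) auto
    moreover have "card {b\<in>T. (a, b) \<in> X} \<le> card T" using finT by (intro card_mono) auto
    ultimately show "card {b\<in>T. (a, b) \<in> X} \<le> min (card {b. (a, b) \<in> X}) n"
      by (simp add: T(2) n'_def)
  qed
  finally show ?thesis .
qed

text \<open>The fuller column has a point in some row where the other column has none. Moving that
  point within its row preserves all row sums.\<close>

lemma gale_ryser_move:
  fixes X :: "('a \<times> 'b) set"
  assumes fin: "finite X" and lt: "card {a. (a, k) \<in> X} < card {a. (a, i) \<in> X}"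
  obtains a where "(a, i) \<in> X" "(a, k) \<notin> X"
    "\<And>x. card {b. (x, b) \<in> insert (a, k) (X - {(a, i)})} = card {b. (x, b) \<in> X}"
    "card {x. (x, i) \<in> insert (a, k) (X - {(a, i)})} = card {a. (a, i) \<in> X} - 1"
    "card {x. (x, k) \<in> insert (a, k) (X - {(a, i)})} = Suc (card {a. (a, k) \<in> X})"
    "\<And>b. \<lbrakk>b \<noteq> i; b \<noteq> k\<rbrakk> \<Longrightarrow>
       {x. (x, b) \<in> insert (a, k) (X - {(a, i)})} = {a. (a, b) \<in> X}"
proof -
  have fincol: "finite {a. (a, b) \<in> X}" for b
    using finite_subset[OF _ finite_imageI[OF fin, of fst], of "{a. (a, b) \<in> X}"] by force
  have finrow: "finite {b. (a, b) \<in> X}" for a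
    using finite_subset[OF _ finite_imageI[OF fin, of snd], of "{b. (a, b) \<in> X}"] by force
  have "\<not> {a. (a, i) \<in> X} \<subseteq> {a. (a, k) \<in> X}"
    using lt card_mono[OF fincol] by (meson not_le)
  then obtain a where a: "(a, i) \<in> X" "(a, k) \<notin> X" by blast
  have "i \<noteq> k" using a by auto
  show thesis
  proof (rule that[OF a])
    fix x
    show "card {b. (x, b) \<in> insert (a, k) (X - {(a, i)})} = card {b. (x, b) \<in> X}"
    proof (cases "x = a")
      case True
      have eq: "{b. (a, b) \<in> insert (a, k) (X - {(a, i)})} = insert k ({b. (a, b) \<in> X} - {i})"
        by auto
      have "card {b. (a, b) \<in> X} > 0" using a finrow card_gt_0_iff by blast
      then show ?thesis
        using a finrow True \<open>i \<noteq> k\<close> unfolding True eq by (simp add: card_Diff_singleton)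
    next
      case False
      then show ?thesis by (intro arg_cong[of _ _ card]) auto
    qed
  next
    have "{x. (x, i) \<in> insert (a, k) (X - {(a, i)})} = {a. (a, i) \<in> X} - {a}"
      using \<open>i \<noteq> k\<close> by auto
    then show "card {x. (x, i) \<in> insert (a, k) (X - {(a, i)})} = card {a. (a, i) \<in> X} - 1"
      using a by (simp add: card_Diff_singleton)
    have "{x. (x, k) \<in> insert (a, k) (X - {(a, i)})} = insert a {a. (a, k) \<in> X}"
      using \<open>i \<noteq> k\<close> by auto
    then show "card {x. (x, k) \<in> insert (a, k) (X - {(a, i)})} = Suc (card {a. (a, k) \<in> X})"
      using a fincol by simp
  qed auto
qed

text \<open>The induction runs on the total surplus of the columns over their targets. Moves may
  destroy the order of the column sums of \<open>X\<close>, so domination is stated with prefix sums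
  in the fixed order of columns, and only the target \<open>\<beta>\<close> is monotone.\<close>

lemma gale_ryser_sufficient:
  fixes X :: "('a \<times> nat) set" and \<beta> :: "nat \<Rightarrow> nat"
  assumes "finite X" "X \<subseteq> A \<times> {..<r}"
    and decr: "\<And>i k. \<lbrakk>i \<le> k; k < r\<rbrakk> \<Longrightarrow> \<beta> k \<le> \<beta> i"
    and "\<And>n. n \<le> r \<Longrightarrow> (\<Sum>b<n. \<beta> b) \<le> (\<Sum>b<n. card {a. (a, b) \<in> X})"
    and "(\<Sum>b<r. \<beta> b) = (\<Sum>b<r. card {a. (a, b) \<in> X})"
  shows "\<exists>Y. finite Y \<and> Y \<subseteq> A \<times> {..<r} \<and>
           (\<forall>a. card {b. (a, b) \<in> Y} = card {b. (a, b) \<in> X}) \<and>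
           (\<forall>b<r. card {a. (a, b) \<in> Y} = \<beta> b)"
  using assms(1,2,4,5)
\<comment> \<open>Truncated subtraction counts surpluses only. A move lowers one surplus and fills a
  deficit without overshooting.\<close>
proof (induction "\<Sum>b<r. card {a. (a, b) \<in> X} - \<beta> b" arbitrary: X rule: less_induct)
  case less
  let ?c = "\<lambda>b. card {a. (a, b) \<in> X}"
  show ?case
  proof (cases "\<forall>b<r. \<beta> b \<le> ?c b")
    case True
    have "\<beta> b = ?c b" if "b < r" for b
    proof (rule ccontr)
      assume "\<beta> b \<noteq> ?c b"
      then have "(\<Sum>b<r. \<beta> b) < (\<Sum>b<r. ?c b)"
        using True that le_neq_implies_less by (intro sum_strict_mono_ex1) blast+
      with less.prems(4) show False by simp
    qed
    with less.prems show ?thesis by (intro exI[of _ X]) auto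
  next
    case False
    txt \<open>
      Columns before \<open>k\<close> have no deficit, so by domination one of them, \<open>i\<close>, has a surplus; then all
      prefix sums ending between \<open>i\<close> and \<open>k\<close> exceed their targets, and a move keeps the domination.
    \<close>
    define k where "k = (LEAST k. k < r \<and> ?c k < \<beta> k)"
    have k: "k < r" "?c k < \<beta> k"
      using False LeastI_ex[of "\<lambda>k. k < r \<and> ?c k < \<beta> k"] by (auto simp: k_def not_le)
    have before: "\<beta> b \<le> ?c b" if "b < k" for b
      using not_less_Least[of b "\<lambda>k. k < r \<and> ?c k < \<beta> k"] that k(1) by (auto simp: k_def[symmetric])
    have "\<exists>i<k. \<beta> i < ?c i"
    proof (rule ccontr)
      assume "\<not> (\<exists>i<k. \<beta> i < ?c i)"
      then have "?c b = \<beta> b" if "b < k" for b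
        using before[OF that] that by (meson le_antisym not_le)
      then have "(\<Sum>b<Suc k. ?c b) < (\<Sum>b<Suc k. \<beta> b)" using k by simp
      with less.prems(3)[of "Suc k"] k show False by simp
    qed
    then obtain i where i: "i < k" "\<beta> i < ?c i" by blast
    \<comment> \<open>Monotonicity of the target links deficit and surplus:
      \<open>?c k < \<beta> k\<close>, \<open>\<beta> k \<le> \<beta> i\<close> and
      \<open>\<beta> i < ?c i\<close>.\<close>
    have "?c k < ?c i" using i k decr[of i k] by simp
    then obtain a where a: "(a, i) \<in> X" "(a, k) \<notin> X"
      "\<And>x. card {b. (x, b) \<in> insert (a, k) (X - {(a, i)})} = card {b. (x, b) \<in> X}"
      "card {x. (x, i) \<in> insert (a, k) (X - {(a, i)})} = card {a. (a, i) \<in> X} - 1"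
      "card {x. (x, k) \<in> insert (a, k) (X - {(a, i)})} = Suc (card {a. (a, k) \<in> X})"
      "\<And>b. \<lbrakk>b \<noteq> i; b \<noteq> k\<rbrakk> \<Longrightarrow>
         {x. (x, b) \<in> insert (a, k) (X - {(a, i)})} = {a. (a, b) \<in> X}"
      using gale_ryser_move[OF less.prems(1)] by blast
    define X' where "X' = insert (a, k) (X - {(a, i)})"
    let ?c' = "\<lambda>b. card {x. (x, b) \<in> X'}"
    note a' = a(3-)[folded X'_def]
    have c': "?c' i + 1 = ?c i" "?c' k = ?c k + 1" "\<And>b. \<lbrakk>b \<noteq> i; b \<noteq> k\<rbrakk> \<Longrightarrow> ?c' b = ?c b"
      using a' i by simp_all
    \<comment> \<open>A prefix sum notices the move only if its range contains \<open>i\<close> but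
      not \<open>k\<close>.\<close>
    have sum_low: "(\<Sum>b<n. ?c' b) = (\<Sum>b<n. ?c b)" if "n \<le> i" for n
      using that i c'(3) by (intro sum.cong) auto
    have sum_mid: "(\<Sum>b<n. ?c' b) + 1 = (\<Sum>b<n. ?c b)" if "i < n" "n \<le> k" for n
      using that i c' by (simp add: sum.remove[of "{..<n}" i])
    have sum_high: "(\<Sum>b<n. ?c' b) = (\<Sum>b<n. ?c b)" if "k < n" for n
    proof -
      have eq: "(\<Sum>b<n. g b) = g i + (g k + (\<Sum>b\<in>{..<n} - {i} - {k}. g b))" for g :: "nat \<Rightarrow> nat"
        using that i by (subst sum.remove[of _ i], simp, simp, subst sum.remove[of _ k]) auto
      show ?thesis unfolding eq[of ?c] eq[of ?c'] using c' by simp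
    qed
    have "\<exists>Y. finite Y \<and> Y \<subseteq> A \<times> {..<r} \<and>
           (\<forall>a. card {b. (a, b) \<in> Y} = card {b. (a, b) \<in> X'}) \<and>
           (\<forall>b<r. card {a. (a, b) \<in> Y} = \<beta> b)"
    proof (rule less.hyps)
      show "(\<Sum>b<r. ?c' b - \<beta> b) < (\<Sum>b<r. ?c b - \<beta> b)"
      proof (intro sum_strict_mono_ex1 ballI)
        fix b assume "b \<in> {..<r}"
        show "?c' b - \<beta> b \<le> ?c b - \<beta> b"
          using c' k by (cases "b = i"; cases "b = k") auto
      next
        show "\<exists>b\<in>{..<r}. ?c' b - \<beta> b < ?c b - \<beta> b"
          using c'(1) i k by (intro bexI[of _ i]) auto
      qed simp
      show "finite X'" "X' \<subseteq> A \<times> {..<r}"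
        using less.prems(1,2) a k by (auto simp: X'_def)
      show "(\<Sum>b<n. \<beta> b) \<le> (\<Sum>b<n. ?c' b)" if "n \<le> r" for n
      proof -
        consider "n \<le> i" | "i < n" "n \<le> k" | "k < n" by linarith
        then show ?thesis
        proof cases
          case 2
          have "(\<Sum>b<n. \<beta> b) < (\<Sum>b<n. ?c b)"
            using 2 i before by (intro sum_strict_mono_ex1) auto
          with sum_mid[OF 2] show ?thesis by simp
        qed (use sum_low sum_high less.prems(3)[OF that] in auto)
      qed
      show "(\<Sum>b<r. \<beta> b) = (\<Sum>b<r. ?c' b)"
        using sum_high[OF k(1)] less.prems(4) by simp
    qed
    then show ?thesis using a' by simp
  qed
qed

section \<open>The last column and row of the Hilbert function\<close>

text \<open>For nonzero \<open>u\<close> this is, as a function of \<open>p\<close>, a linear form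
  whose only zero on the projective line is the point with coordinates \<open>u\<close>.\<close>

definition det2 :: "'k::field \<times> 'k \<Rightarrow> 'k \<times> 'k \<Rightarrow> 'k" where
  "det2 u p = fst u * snd p - snd u * fst p"

text \<open>These products serve as separating forms. Lists rather than sets allow repeated factors,
  which are used to reach a prescribed degree.\<close>

lemma bihom_piece_product_of_linear_forms:
  fixes us vs :: "('k::field \<times> 'k) list"
  shows "\<exists>f\<in>bihom_piece (length us) (length vs). \<forall>p q. eval_bipoly f (coords p q) =
           prod_list (map (\<lambda>u. det2 u p) us) * prod_list (map (\<lambda>v. det2 v q) vs)"
proof (induction us)
  case Nil
  show ?case
  proof (induction vs)
    case Nil
    show ?case
      using bihom_piece_const[of "1 :: 'k"] eval_bipoly_single[of 0 "1 :: 'k"]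
      by (intro bexI[of _ 1]) simp_all
  next
    case (Cons v vs)
    define L where "L = Poly_Mapping.single (Poly_Mapping.single Y1 1) (fst v) -
      Poly_Mapping.single (Poly_Mapping.single Y0 (1::nat)) (snd v)"
    have L: "L \<in> bihom_piece 0 1" unfolding L_def
      by (intro bihom_piece_diff) (auto simp: bihom_piece_def lookup_single)
    have eval_L: "eval_bipoly L (coords p q) = det2 v q" for p q
      by (simp add: L_def det2_def monomial_value_coords lookup_single)
    from Cons.IH obtain f where "f \<in> bihom_piece 0 (length vs)" "\<forall>p q. eval_bipoly f (coords p q) =
        prod_list (map (\<lambda>v. det2 v q) vs)"
      by auto
    then show ?case
      using bihom_piece_mult[OF L, of f 0 "length vs"]
      by (intro bexI[of _ "L * f"]) (simp_all add: eval_L)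
  qed
next
  case (Cons u us)
  define L where "L = Poly_Mapping.single (Poly_Mapping.single X1 1) (fst u) -
    Poly_Mapping.single (Poly_Mapping.single X0 (1::nat)) (snd u)"
  have L: "L \<in> bihom_piece 1 0" unfolding L_def
    by (intro bihom_piece_diff) (auto simp: bihom_piece_def lookup_single)
  have eval_L: "eval_bipoly L (coords p q) = det2 u p" for p q
    by (simp add: L_def det2_def monomial_value_coords lookup_single)
  from Cons.IH obtain f where "f \<in> bihom_piece (length us) (length vs)"
      "\<forall>p q. eval_bipoly f (coords p q) =
        prod_list (map (\<lambda>u. det2 u p) us) * prod_list (map (\<lambda>v. det2 v q) vs)"
    by auto
  then show ?case
    using bihom_piece_mult[OF L, of f "length us" "length vs"]
    by (intro bexI[of _ "L * f"]) (simp_all add: eval_L mult.assoc)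
qed

text \<open>
  The family \<open>W\<close> abstracts the functions defined by forms of bidegree \<open>(t - 1, j)\<close>, so that the
  statement also applies with the two factors exchanged.
\<close>

lemma fibrewise_basis:
  fixes X :: "'k::field point set" and W :: "('k \<times> 'k \<Rightarrow> 'k \<times> 'k \<Rightarrow> 'k) set"
  assumes X: "X \<subseteq> proj_line \<times> proj_line" "finite X"
    and form: "\<And>F p. F \<in> W \<Longrightarrow> \<exists>c. \<forall>q. F p q = (\<Sum>l\<le>j. c l * fst q ^ l * snd q ^ (j - l))"
    and prods: "\<And>us vs. \<lbrakk>length us = card (fst ` X) - 1; length vs = j\<rbrakk> \<Longrightarrow>
      \<exists>F\<in>W. \<forall>p q. F p q = prod_list (map (\<lambda>u. det2 u p) us) * prod_list (map (\<lambda>v. det2 v q) vs)"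
  obtains S where "S \<subseteq> X" "card S = (\<Sum>P\<in>fst ` X. min (card (X `` {P})) (j + 1))"
    "\<And>F x. \<lbrakk>F \<in> W; \<And>y. y \<in> S \<Longrightarrow> F (proj_rep (fst y)) (proj_rep (snd y)) = 0; x \<in> X\<rbrakk>
      \<Longrightarrow> F (proj_rep (fst x)) (proj_rep (snd x)) = 0"
    "\<And>x. x \<in> S \<Longrightarrow> \<exists>F\<in>W. F (proj_rep (fst x)) (proj_rep (snd x)) \<noteq> 0 \<and>
      (\<forall>y\<in>S - {x}. F (proj_rep (fst y)) (proj_rep (snd y)) = 0)"
proof -
  have fib: "finite (X `` {P})" for P
    using finite_subset[OF _ finite_imageI[OF X(2), of snd], of "X `` {P}"] by force
  \<comment> \<open>A binary form of degree \<open>j\<close> is determined by its values at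
    \<open>j + 1\<close> points, so that many points represent a larger fibre; a smaller fibre is
    kept whole.\<close>
  have "\<exists>T\<subseteq>X `` {P}. card T = min (card (X `` {P})) (j + 1)" for P
    using obtain_subset_with_card_n[OF min.cobounded1] by metis
  then obtain T where T: "\<And>P. T P \<subseteq> X `` {P}" "\<And>P. card (T P) = min (card (X `` {P})) (j + 1)"
    by metis
  have finT: "finite (T P)" for P using T(1) fib finite_subset by blast
  define S where "S = Sigma (fst ` X) T"
  show thesis
  proof (rule that[of S])
    show "S \<subseteq> X" using T(1) by (auto simp: S_def)
    show "card S = (\<Sum>P\<in>fst ` X. min (card (X `` {P})) (j + 1))"
      using X(2) finT by (simp add: S_def T(2))
  next
    fix F x assume F: "F \<in> W" "\<And>y. y \<in> S \<Longrightarrow> F (proj_rep (fst y)) (proj_rep (snd y)) = 0"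
      and x: "x \<in> X"
    obtain P Q where PQ: "x = (P, Q)" by force
    have TP: "F (proj_rep P) (proj_rep Q) = 0" if "Q \<in> T P" for Q
      using F(2)[of "(P, Q)"] that image_eqI[of P fst x X] x PQ by (simp add: S_def)
    show "F (proj_rep (fst x)) (proj_rep (snd x)) = 0"
    proof (cases "card (X `` {P}) \<le> j + 1")
      case True
      then have "T P = X `` {P}" using T fib by (intro card_subset_eq) auto
      then show ?thesis using TP[of Q] x PQ by simp
    next
      case False
      obtain c where c: "\<And>q. F (proj_rep P) q = (\<Sum>l\<le>j. c l * fst q ^ l * snd q ^ (j - l))"
        using form[OF F(1)] by blast
      have line: "Q \<in> proj_line" if "Q \<in> T P" for Q using that T(1)[of P] X(1) by auto
      have indep: "fst (proj_rep Q) * snd (proj_rep Q') \<noteq> snd (proj_rep Q) * fst (proj_rep Q')"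
        if "Q \<in> T P" "Q' \<in> T P" "Q \<noteq> Q'" for Q Q'
        using proj_rep_independent line that by blast
      have "inj_on proj_rep (T P)"
        using indep unfolding inj_on_def by (metis mult.commute)
      then have card: "j < card (proj_rep ` T P)"
        using False by (simp add: card_image T(2))
      have "c l = 0" if "l \<le> j" for l
      proof (rule binary_form_eq_0[OF _ card _ _ _ that])
        show "finite (proj_rep ` T P)" using finT by simp
        show "(0, 0) \<notin> proj_rep ` T P" using proj_rep_nonzero line by force
        show "fst u * snd v \<noteq> snd u * fst v"
          if "u \<in> proj_rep ` T P" "v \<in> proj_rep ` T P" "u \<noteq> v" for u v
          using that indep by blast
        show "(\<Sum>l\<le>j. c l * fst u ^ l * snd u ^ (j - l)) = 0" if "u \<in> proj_rep ` T P" for u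
          using that TP c[of u] by auto
      qed
      then show ?thesis using c PQ by simp
    qed
  next
    fix x assume x: "x \<in> S"
    obtain P Q where PQ: "x = (P, Q)" by force
    have P: "P \<in> fst ` X" and Q: "Q \<in> T P" using x PQ by (auto simp: S_def)
    have lines: "P' \<in> proj_line" if "P' \<in> fst ` X" for P' using that X(1) by auto
    have lines': "Q' \<in> proj_line" if "Q' \<in> T P" for Q' using that T(1)[of P] X(1) by auto
    obtain us0 where us0: "set us0 = fst ` X - {P}" "distinct us0"
      using finite_distinct_list[of "fst ` X - {P}"] X(2) by auto
    obtain vs0 where vs0: "set vs0 = T P - {Q}" "distinct vs0"
      using finite_distinct_list[of "T P - {Q}"] finT by auto
    \<comment> \<open>A padding factor: a linear form that does not vanish at \<open>Q\<close>, used
      to raise the degree to exactly \<open>j\<close>.\<close>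
    define w where "w = (if snd (proj_rep Q) = 0 then (0 :: 'k, 1 :: 'k) else (1, 0))"
    have w: "det2 w (proj_rep Q) \<noteq> 0"
      using proj_rep_nonzero[OF lines'[OF Q]] by (auto simp: w_def det2_def prod_eq_iff)
    \<comment> \<open>One factor for each of the other fibres. Their number is exactly the available
      degree in the first factor, which is why the last column is accessible.\<close>
    define us where "us = map proj_rep us0"
    define vs where "vs = map proj_rep vs0 @ replicate (j - length vs0) w"
    have len_us: "length us = card (fst ` X) - 1"
      using us0 P X(2) by (simp add: us_def distinct_card[symmetric])
    \<comment> \<open>Removing \<open>Q\<close> from at most \<open>j + 1\<close> chosen points of
      the fibre leaves at most \<open>j\<close> zeros to impose.\<close>
    have "length vs0 \<le> j"
      using vs0 Q finT T(2)[of P] by (simp add: distinct_card[symmetric])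
    then have len_vs: "length vs = j" by (simp add: vs_def)
    obtain F where "F \<in> W" and F_eq: "\<forall>p q. F p q =
        prod_list (map (\<lambda>u. det2 u p) us) * prod_list (map (\<lambda>v. det2 v q) vs)"
      using prods[OF len_us len_vs] unfolding Bex_def by (elim exE conjE)
    note F = \<open>F \<in> W\<close> F_eq[rule_format]
    have "det2 u (proj_rep P) \<noteq> 0" if "u \<in> set us" for u
    proof -
      from that have "u \<in> proj_rep ` (fst ` X - {P})" by (simp only: us_def set_map us0)
      then obtain P' where "u = proj_rep P'" "P' \<in> fst ` X - {P}" by (rule imageE)
      then show ?thesis
        using proj_rep_independent[of P' P] lines P by (simp add: det2_def)
    qed
    moreover have "det2 v (proj_rep Q) \<noteq> 0" if "v \<in> set vs" for v
    proof (cases "v = w")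
      case False
      with that obtain Q' where "v = proj_rep Q'" "Q' \<in> T P" "Q' \<noteq> Q"
        using vs0(1) by (auto simp: vs_def)
      then show ?thesis
        using proj_rep_independent[of Q' Q] lines' Q by (simp add: det2_def)
    qed (use w in simp)
    ultimately have nonzero: "F (proj_rep P) (proj_rep Q) \<noteq> 0"
      by (auto simp: F(2) prod_list_zero_iff)
    have vanish: "F (proj_rep P') (proj_rep Q') = 0" if "(P', Q') \<in> S - {x}" for P' Q'
    proof (cases "P' = P")
      case True
      with that PQ have "Q' \<in> set vs0" by (auto simp: S_def vs0)
      then have "proj_rep Q' \<in> set vs" by (simp add: vs_def)
      moreover have "det2 (proj_rep Q') (proj_rep Q') = 0" by (simp add: det2_def)
      ultimately show ?thesis unfolding F(2) mult_eq_0_iff prod_list_zero_iff set_map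
        by (metis image_eqI)
    next
      case False
      with that have "P' \<in> set us0" by (auto simp: S_def us0)
      then have "proj_rep P' \<in> set us" by (simp add: us_def)
      moreover have "det2 (proj_rep P') (proj_rep P') = 0" by (simp add: det2_def)
      ultimately show ?thesis unfolding F(2) mult_eq_0_iff prod_list_zero_iff set_map
        by (metis image_eqI)
    qed
    show "\<exists>F\<in>W. F (proj_rep (fst x)) (proj_rep (snd x)) \<noteq> 0 \<and>
      (\<forall>y\<in>S - {x}. F (proj_rep (fst y)) (proj_rep (snd y)) = 0)"
    proof (intro bexI[of _ F] conjI ballI)
      show "F (proj_rep (fst x)) (proj_rep (snd x)) \<noteq> 0" using nonzero by (simp add: PQ)
      show "F (proj_rep (fst y)) (proj_rep (snd y)) = 0" if "y \<in> S - {x}" for y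
        using vanish[of "fst y" "snd y"] that by simp
    qed (rule F(1))
  qed
qed

lemma hilbert_fun_last_column:
  fixes X :: "'k::field point set"
  assumes X: "X \<subseteq> proj_line \<times> proj_line" "finite X" "X \<noteq> {}"
  shows "hilbert_fun X (card (fst ` X) - 1) j = (\<Sum>P\<in>fst ` X. min (card (X `` {P})) (j + 1))"
proof (rule fibrewise_basis[OF X(1,2), of
      "(\<lambda>f p q. eval_bipoly f (coords p q)) ` bihom_piece (card (fst ` X) - 1) j" j])
  let ?V = "bihom_piece (card (fst ` X) - 1) j :: 'k bipoly set"
  let ?W = "(\<lambda>f p q. eval_bipoly f (coords p q)) ` ?V"
  show "\<exists>c. \<forall>q. F p q = (\<Sum>l\<le>j. c l * fst q ^ l * snd q ^ (j - l))" if "F \<in> ?W" for F p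
    using that by (elim imageE) (simp only: eval_bipoly_binary_form(1))
  fix us vs :: "('k \<times> 'k) list" assume "length us = card (fst ` X) - 1" "length vs = j"
  with bihom_piece_product_of_linear_forms[of us vs]
  show "\<exists>F\<in>?W. \<forall>p q. F p q =
      prod_list (map (\<lambda>u. det2 u p) us) * prod_list (map (\<lambda>v. det2 v q) vs)"
    by simp
next
  let ?V = "bihom_piece (card (fst ` X) - 1) j :: 'k bipoly set"
  let ?W = "(\<lambda>f p q. eval_bipoly f (coords p q)) ` ?V"
  fix S assume S: "S \<subseteq> X" "card S = (\<Sum>P\<in>fst ` X. min (card (X `` {P})) (j + 1))"
    and determined: "\<And>F x. \<lbrakk>F \<in> ?W; \<And>y. y \<in> S \<Longrightarrow> F (proj_rep (fst y)) (proj_rep (snd y)) = 0; x \<in> X\<rbrakk>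
      \<Longrightarrow> F (proj_rep (fst x)) (proj_rep (snd x)) = 0"
    and separated: "\<And>x. x \<in> S \<Longrightarrow> \<exists>F\<in>?W. F (proj_rep (fst x)) (proj_rep (snd x)) \<noteq> 0 \<and>
      (\<forall>y\<in>S - {x}. F (proj_rep (fst y)) (proj_rep (snd y)) = 0)"
  have "hilbert_fun X (card (fst ` X) - 1) j = card S"
  proof (rule hilbert_fun_eq_card[OF X(1,3) S(1) finite_subset[OF S(1) X(2)]])
    show "eval_at f x = 0" if "f \<in> ?V" "\<And>y. y \<in> S \<Longrightarrow> eval_at f y = 0" "x \<in> X" for f x
      using determined[OF imageI[OF that(1)] _ that(3)] that(2) by (simp add: eval_at_def)
    show "\<exists>f\<in>?V. eval_at f x \<noteq> 0 \<and> (\<forall>y\<in>S - {x}. eval_at f y = 0)" if "x \<in> S" for x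
      using separated[OF that] by (simp add: eval_at_def)
  qed
  then show ?thesis by (simp only: S(2))
qed

text \<open>The factors are exchanged in the point set and in the order of the arguments of
  evaluation, while the polynomials stay as they are.\<close>

lemma hilbert_fun_last_row:
  fixes X :: "'k::field point set"
  assumes X: "X \<subseteq> proj_line \<times> proj_line" "finite X" "X \<noteq> {}"
  shows "hilbert_fun X i (card (snd ` X) - 1) = (\<Sum>Q\<in>snd ` X. min (card (X\<inverse> `` {Q})) (i + 1))"
proof -
  have X': "X\<inverse> \<subseteq> proj_line \<times> proj_line" "finite (X\<inverse>)"
    using X by auto
  have fst_X': "fst ` (X\<inverse>) = snd ` X" by force
  let ?V = "bihom_piece i (card (snd ` X) - 1) :: 'k bipoly set"
  let ?W = "(\<lambda>f q p. eval_bipoly f (coords p q)) ` ?V"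
  show ?thesis
  proof (rule fibrewise_basis[OF X', of ?W i, unfolded fst_X'])
    show "\<exists>c. \<forall>q. F p q = (\<Sum>l\<le>i. c l * fst q ^ l * snd q ^ (i - l))" if "F \<in> ?W" for F p
      using that by (elim imageE) (simp only: eval_bipoly_binary_form(2))
    fix us vs :: "('k \<times> 'k) list" assume "length us = card (snd ` X) - 1" "length vs = i"
    with bihom_piece_product_of_linear_forms[of vs us]
    obtain f where f: "f \<in> ?V" "\<forall>p q. eval_bipoly f (coords p q) =
        prod_list (map (\<lambda>v. det2 v p) vs) * prod_list (map (\<lambda>u. det2 u q) us)"
      unfolding Bex_def by (elim exE conjE) simp
    show "\<exists>F\<in>?W. \<forall>p q. F p q =
        prod_list (map (\<lambda>u. det2 u p) us) * prod_list (map (\<lambda>v. det2 v q) vs)"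
      by (rule bexI[OF _ imageI[OF f(1)]]) (simp only: f(2)[rule_format] mult.commute simp_thms)
  next
    fix S assume S: "S \<subseteq> X\<inverse>" "card S = (\<Sum>Q\<in>snd ` X. min (card (X\<inverse> `` {Q})) (i + 1))"
      and determined: "\<And>F x. \<lbrakk>F \<in> ?W; \<And>y. y \<in> S \<Longrightarrow> F (proj_rep (fst y)) (proj_rep (snd y)) = 0;
          x \<in> X\<inverse>\<rbrakk> \<Longrightarrow> F (proj_rep (fst x)) (proj_rep (snd x)) = 0"
      and separated: "\<And>x. x \<in> S \<Longrightarrow> \<exists>F\<in>?W. F (proj_rep (fst x)) (proj_rep (snd x)) \<noteq> 0 \<and>
        (\<forall>y\<in>S - {x}. F (proj_rep (fst y)) (proj_rep (snd y)) = 0)"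
    have S': "S\<inverse> \<subseteq> X" using S(1) by auto
    have "hilbert_fun X i (card (snd ` X) - 1) = card (S\<inverse>)"
    proof (rule hilbert_fun_eq_card[OF X(1,3) S' finite_subset[OF S' X(2)]])
      fix f x assume f: "f \<in> ?V" "\<And>y. y \<in> S\<inverse> \<Longrightarrow> eval_at f y = 0" and x: "x \<in> X"
      have zero: "eval_bipoly f (coords (proj_rep (snd y)) (proj_rep (fst y))) = 0" if "y \<in> S" for y
        using f(2)[of "(snd y, fst y)"] that by (simp add: eval_at_def)
      have "(snd x, fst x) \<in> X\<inverse>" using x by simp
      from determined[OF imageI[OF f(1)] zero this] show "eval_at f x = 0"
        by (simp add: eval_at_def)
    next
      fix x assume "x \<in> S\<inverse>"
      then have "(snd x, fst x) \<in> S" by (cases x) simp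
      from separated[OF this] obtain f where f: "f \<in> ?V" "eval_at f x \<noteq> 0"
        and zero: "\<forall>y\<in>S - {(snd x, fst x)}.
          eval_bipoly f (coords (proj_rep (snd y)) (proj_rep (fst y))) = 0"
        by (auto simp: eval_at_def)
      have "eval_at f y = 0" if "y \<in> S\<inverse> - {x}" for y
        using bspec[OF zero, of "(snd y, fst y)"] that
        by (cases x; cases y) (auto simp: eval_at_def)
      with f show "\<exists>f\<in>?V. eval_at f x \<noteq> 0 \<and> (\<forall>y\<in>S\<inverse> - {x}. eval_at f y = 0)" by blast
    qed
    then show "hilbert_fun X i (card (snd ` X) - 1) =
        (\<Sum>Q\<in>snd ` X. min (card (X\<inverse> `` {Q})) (i + 1))"
      by (simp only: card_inverse S(2))
  qed
qed

section \<open>Difference tuples and partitions\<close>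

lemma sum_list_take_map_upt:
  fixes f :: "nat \<Rightarrow> 'a::comm_monoid_add"
  shows "sum_list (take n (map f [0..<r])) = (\<Sum>i<min n r. f i)"
proof -
  have "take n [0..<r] = [0..<min n r]" by (cases "n \<le> r") simp_all
  then show ?thesis
    by (simp add: take_map interv_sum_list_conv_sum_set_nat atLeast0LessThan)
qed

lemma sum_list_take_diff_tuple:
  assumes "j < length p"
  shows "sum_list (take (Suc j) (diff_tuple p)) = p ! j"
proof -
  have "sum_list (take (Suc j) (diff_tuple p)) = (\<Sum>i<Suc j. if i = 0 then p ! 0 else p ! i - p ! (i - 1))"
    using assms unfolding diff_tuple_def sum_list_take_map_upt by (simp add: min_absorb1)
  also have "\<dots> = p ! j"
    by (induction j) simp_all
  finally show ?thesis .
qed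

text \<open>Partial sums of the differences telescope back to the tuple, so matching differences
  suffices to match eventual vectors.\<close>

lemma diff_tuple_inject:
  assumes "diff_tuple p = diff_tuple q"
  shows "p = q"
proof (rule nth_equalityI)
  have len: "length (diff_tuple p) = length p" for p by (simp add: diff_tuple_def)
  show "length p = length q" using assms len by metis
  then show "p ! i = q ! i" if "i < length p" for i
    using that sum_list_take_diff_tuple assms by metis
qed

text \<open>Raising the cap from \<open>j\<close> to \<open>j + 1\<close> adds 1 for every
  \<open>a\<close> with \<open>j < d a\<close>. This is how the conjugate of the fibre sizes arises
  from the Hilbert function.\<close>

lemma diff_tuple_sum_min:
  fixes d :: "'a \<Rightarrow> nat"
  assumes "finite A"
  shows "diff_tuple (map (\<lambda>j. int (\<Sum>a\<in>A. min (d a) (j + 1))) [0..<r]) =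
         map (\<lambda>j. int (card {a\<in>A. j < d a})) [0..<r]"
proof (rule nth_equalityI)
  fix i assume "i < length (diff_tuple (map (\<lambda>j. int (\<Sum>a\<in>A. min (d a) (j + 1))) [0..<r]))"
  then have "i < r" by (simp add: diff_tuple_def)
  then show "diff_tuple (map (\<lambda>j. int (\<Sum>a\<in>A. min (d a) (j + 1))) [0..<r]) ! i =
      map (\<lambda>j. int (card {a\<in>A. j < d a})) [0..<r] ! i"
    unfolding sum_min_eq_sum_card[OF assms] by (cases i) (simp_all add: diff_tuple_def)
qed (simp add: diff_tuple_def)

lemma diff_tuple_eventual_column:
  assumes "X \<subseteq> proj_line \<times> proj_line" "finite X" "X \<noteq> {}"
  shows "diff_tuple (eventual_column X) =
    map (\<lambda>j. int (card {P\<in>fst ` X. j < card (X `` {P})})) [0..<card (snd ` X)]"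
  unfolding eventual_column_def hilbert_fun_last_column[OF assms]
  using assms(2) by (intro diff_tuple_sum_min) simp

lemma diff_tuple_eventual_row:
  assumes "X \<subseteq> proj_line \<times> proj_line" "finite X" "X \<noteq> {}"
  shows "diff_tuple (eventual_row X) =
    map (\<lambda>i. int (card {Q\<in>snd ` X. i < card (X\<inverse> `` {Q})})) [0..<card (fst ` X)]"
  unfolding eventual_row_def hilbert_fun_last_row[OF assms]
  using assms(2) by (intro diff_tuple_sum_min) simp

text \<open>Conjugate entries are indexed from 1 in the definition and from 0 here, so the condition
  \<open>i + 1 \<le> d j\<close> becomes \<open>i < d j\<close>.\<close>

lemma conjugate_map_upt:
  fixes d :: "nat \<Rightarrow> nat"
  assumes "t \<ge> 1"
  shows "conjugate (map (\<lambda>j. int (d j)) [0..<t]) =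
         map (\<lambda>i. int (card {j. j < t \<and> i < d j})) [0..<d 0]"
proof (rule nth_equalityI)
  show "length (conjugate (map (\<lambda>j. int (d j)) [0..<t])) =
      length (map (\<lambda>i. int (card {j. j < t \<and> i < d j})) [0..<d 0])"
    using assms by (simp add: conjugate_def)
  fix i assume "i < length (conjugate (map (\<lambda>j. int (d j)) [0..<t]))"
  then have "i < d 0" using assms by (simp add: conjugate_def)
  moreover have "{j. j < t \<and> 1 + int i \<le> map (\<lambda>j. int (d j)) [0..<t] ! j} = {j. j < t \<and> i < d j}"
    by auto
  ultimately show "conjugate (map (\<lambda>j. int (d j)) [0..<t]) ! i =
      map (\<lambda>i. int (card {j. j < t \<and> i < d j})) [0..<d 0] ! i"
    using assms by (simp add: conjugate_def)
qed

text \<open>For a non-increasing \<open>d\<close> the set of \<open>j\<close> with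
  \<open>b < d j\<close> is an initial segment, so lying in it means lying below its
  cardinality.\<close>

lemma less_card_iff:
  fixes d :: "nat \<Rightarrow> nat"
  assumes decr: "\<And>i k. \<lbrakk>i \<le> k; k < t\<rbrakk> \<Longrightarrow> d k \<le> d i" and "i < t"
  shows "i < card {j. j < t \<and> b < d j} \<longleftrightarrow> b < d i"
proof
  assume lt: "i < card {j. j < t \<and> b < d j}"
  show "b < d i"
  proof (rule ccontr)
    assume "\<not> b < d i"
    have "{j. j < t \<and> b < d j} \<subseteq> {..<i}"
    proof
      fix j assume "j \<in> {j. j < t \<and> b < d j}"
      then show "j \<in> {..<i}" using decr[of i j] \<open>\<not> b < d i\<close> by (cases "i \<le> j") auto
    qed
    then have "card {j. j < t \<and> b < d j} \<le> card {..<i}" by (intro card_mono) auto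
    with lt show False by simp
  qed
next
  assume "b < d i"
  then have "{..i} \<subseteq> {j. j < t \<and> b < d j}"
    using decr[of _ i] \<open>i < t\<close> by (auto intro: less_le_trans)
  then have "card {..i} \<le> card {j. j < t \<and> b < d j}" by (intro card_mono) auto
  then show "i < card {j. j < t \<and> b < d j}" by simp
qed

text \<open>Conjugation of partitions is an involution; the bound \<open>d i \<le> r\<close> ensures
  that restricting to \<open>b < r\<close> loses nothing.\<close>

lemma card_less_conjugate:
  fixes d :: "nat \<Rightarrow> nat"
  assumes decr: "\<And>i k. \<lbrakk>i \<le> k; k < t\<rbrakk> \<Longrightarrow> d k \<le> d i" and "i < t" "d i \<le> r"
  shows "card {b. b < r \<and> i < card {j. j < t \<and> b < d j}} = d i"
proof -
  have "{b. b < r \<and> i < card {j. j < t \<and> b < d j}} = {..<d i}"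
    using less_card_iff[of t d i] assms by auto
  then show ?thesis by simp
qed

lemma is_partition_upt:
  assumes "is_partition p s"
  obtains d where "p = map (\<lambda>j. int (d j)) [0..<length p]" "(\<Sum>j<length p. d j) = s"
    "\<And>i k. \<lbrakk>i \<le> k; k < length p\<rbrakk> \<Longrightarrow> d k \<le> d i"
proof
  let ?d = "\<lambda>j. nat (p ! j)"
  show eq: "p = map (\<lambda>j. int (?d j)) [0..<length p]"
    using assms by (intro nth_equalityI) (auto simp: is_partition_def)
  have "int s = sum_list (take (length p) (map (\<lambda>j. int (?d j)) [0..<length p]))"
    using assms eq by (simp add: is_partition_def)
  also have "\<dots> = int (\<Sum>j<length p. ?d j)"
    unfolding sum_list_take_map_upt by (simp only: of_nat_sum min.idem)
  finally show "(\<Sum>j<length p. ?d j) = s" by (simp only: of_nat_eq_iff)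
  show "?d k \<le> ?d i" if "i \<le> k" "k < length p" for i k
    using assms that sorted_wrt_nth_less[of "(\<ge>)" p i k]
    by (cases "i = k") (auto simp: is_partition_def)
qed

section \<open>Distinct points on the projective line\<close>

definition affine_point :: "nat \<Rightarrow> ('k::field \<times> 'k) set" where
  "affine_point n = proj_rel `` {(of_nat n, 1)}"

lemma affine_point_in: "affine_point n \<in> proj_line"
  unfolding affine_point_def proj_line_def by (rule quotientI) simp

text \<open>The common second coordinate 1 forces the scaling factor to be 1, and in characteristic
  zero distinct naturals have distinct images.\<close>

lemma inj_affine_point: "inj (affine_point :: nat \<Rightarrow> ('k::field_char_0 \<times> 'k) set)"
proof (rule injI)
  fix m n assume "affine_point m = (affine_point n :: ('k \<times> 'k) set)"
  then have "((of_nat m, 1), (of_nat n, 1 :: 'k)) \<in> proj_rel"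
    unfolding affine_point_def by (intro eq_equiv_class[OF _ equiv_proj_rel]) simp_all
  then show "m = n" by (auto simp: proj_rel_def)
qed

theorem corollary5p18:
  fixes B_C B_R :: "int list" and r t s :: nat
  assumes "r \<ge> 1" and "t \<ge> 1"
    and "length B_C = r" and "length B_R = t"
    and "B_C ! 0 = int t" and "B_R ! 0 = int r"
    and "is_partition (diff_tuple B_C) s"
    and "is_partition (diff_tuple B_R) s"
  shows "(\<exists>X :: 'k::{alg_closed_field, field_char_0} point set.
            X \<subseteq> proj_line \<times> proj_line \<and> finite X \<and> card X = s \<and>
            eventual_column X = B_C \<and> eventual_row X = B_R)
         \<longleftrightarrow> diff_tuple B_C \<unrhd> conjugate (diff_tuple B_R)"
proof -
  have len: "length (diff_tuple B_C) = r" "length (diff_tuple B_R) = t"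
    using assms(3,4) by (simp_all add: diff_tuple_def)
  obtain \<gamma> where \<gamma>: "diff_tuple B_C = map (\<lambda>j. int (\<gamma> j)) [0..<r]" "(\<Sum>j<r. \<gamma> j) = s"
    "\<And>i k. \<lbrakk>i \<le> k; k < r\<rbrakk> \<Longrightarrow> \<gamma> k \<le> \<gamma> i"
    using is_partition_upt[OF assms(7), unfolded len] by blast
  obtain \<mu> where \<mu>: "diff_tuple B_R = map (\<lambda>j. int (\<mu> j)) [0..<t]" "(\<Sum>j<t. \<mu> j) = s"
    "\<And>i k. \<lbrakk>i \<le> k; k < t\<rbrakk> \<Longrightarrow> \<mu> k \<le> \<mu> i"
    using is_partition_upt[OF assms(8), unfolded len] by blast
  have "diff_tuple B_C ! 0 = int t" "diff_tuple B_R ! 0 = int r"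
    using assms(1-6) by (simp_all add: diff_tuple_def)
  then have \<gamma>0: "\<gamma> 0 = t" and \<mu>0: "\<mu> 0 = r"
    using assms(1,2) by (simp_all add: \<gamma>(1) \<mu>(1))
  \<comment> \<open>The entries of the conjugate of the row difference: the column sums that the
    point set has to realise.\<close>
  define \<kappa> where "\<kappa> b = card {j. j < t \<and> b < \<mu> j}" for b
  have sum_\<kappa>: "(\<Sum>b<n. \<kappa> b) = (\<Sum>j<t. min (\<mu> j) n)" for n
    using sum_min_eq_sum_card[of "{..<t}" \<mu> n] by (simp add: \<kappa>_def)
  have "conjugate (diff_tuple B_R) = map (\<lambda>b. int (\<kappa> b)) [0..<r]"
    unfolding \<mu>(1) conjugate_map_upt[OF assms(2)] by (simp add: \<mu>0 \<kappa>_def)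
  then have "diff_tuple B_C \<unrhd> conjugate (diff_tuple B_R) \<longleftrightarrow>
      (\<forall>n. (\<Sum>b<min n r. \<kappa> b) \<le> (\<Sum>b<min n r. \<gamma> b))"
    by (simp add: majorizes_def \<gamma>(1) sum_list_take_map_upt flip: of_nat_sum)
  \<comment> \<open>Both tuples have length \<open>r\<close>, the conjugate because
    \<open>\<mu> 0 = r\<close>, so partial sums beyond \<open>r\<close> repeat the one at
    \<open>r\<close>.\<close>
  also have "\<dots> \<longleftrightarrow> (\<forall>n\<le>r. (\<Sum>b<n. \<kappa> b) \<le> (\<Sum>b<n. \<gamma> b))"
    by (metis min.absorb1 min.cobounded2)
  finally have major: "diff_tuple B_C \<unrhd> conjugate (diff_tuple B_R) \<longleftrightarrow>
      (\<forall>n\<le>r. (\<Sum>b<n. \<kappa> b) \<le> (\<Sum>b<n. \<gamma> b))" .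
  show ?thesis unfolding major
  proof (intro iffI allI impI)
    fix n assume "n \<le> r"
    assume "\<exists>X :: 'k point set. X \<subseteq> proj_line \<times> proj_line \<and> finite X \<and> card X = s \<and>
            eventual_column X = B_C \<and> eventual_row X = B_R"
    then obtain X :: "'k point set" where X: "X \<subseteq> proj_line \<times> proj_line" "finite X" "card X = s"
      "eventual_column X = B_C" "eventual_row X = B_R" by blast
    \<comment> \<open>The lengths of the eventual vectors record the sizes of the two
      projections.\<close>
    have cards: "card (snd ` X) = r" "card (fst ` X) = t"
      using X(4,5) assms(3,4) by (auto simp: eventual_column_def eventual_row_def)
    then have "X \<noteq> {}" using assms(1) by auto
    have \<gamma>_X: "\<gamma> j = card {P\<in>fst ` X. j < card (X `` {P})}" if "j < r" for j
      using diff_tuple_eventual_column[OF X(1,2) \<open>X \<noteq> {}\<close>] that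
      unfolding X(4) \<gamma>(1) cards by simp
    have \<mu>_X: "\<mu> j = card {Q\<in>snd ` X. j < card {P. (P, Q) \<in> X}}" if "j < t" for j
      using diff_tuple_eventual_row[OF X(1,2) \<open>X \<noteq> {}\<close>] that
      unfolding X(5) \<mu>(1) cards by (simp add: Image_singleton)
    \<comment> \<open>Written with truncated entries of \<open>\<mu>\<close>, the prefix sum takes
      the form bounded by the necessity half of Gale-Ryser with \<open>m = t\<close>, and the fibres
      remain unsorted.\<close>
    have "(\<Sum>b<n. \<kappa> b) = (\<Sum>j<t. min (card {Q\<in>snd ` X. j < card {P. (P, Q) \<in> X}}) n)"
      unfolding sum_\<kappa> by (intro sum.cong) (simp_all add: \<mu>_X)
    also have "\<dots> \<le> (\<Sum>P\<in>fst ` X. min (card {Q. (P, Q) \<in> X}) n)"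
      using X(2) by (intro gale_ryser_necessary) force+
    also have "\<dots> = (\<Sum>b<n. \<gamma> b)"
      using X(2) \<open>n \<le> r\<close> by (simp add: sum_min_eq_sum_card \<gamma>_X Image_singleton)
    finally show "(\<Sum>b<n. \<kappa> b) \<le> (\<Sum>b<n. \<gamma> b)" .
  next
    assume dom: "\<forall>n\<le>r. (\<Sum>b<n. \<kappa> b) \<le> (\<Sum>b<n. \<gamma> b)"
    \<comment> \<open>The Ferrers diagram with column heights \<open>\<gamma>\<close>, stored as
      pairs of column and row; its converse has the row sums conjugate to \<open>\<gamma>\<close>,
      which the moves preserve.\<close>
    define Y0 where "Y0 = Sigma {..<r} (\<lambda>b. {..<\<gamma> b})"
    have \<gamma>_le: "\<gamma> b \<le> t" if "b < r" for b using \<gamma>(3)[of 0 b] that \<gamma>0 by simp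
    have \<mu>_le: "\<mu> j \<le> r" if "j < t" for j using \<mu>(3)[of 0 j] that \<mu>0 by simp
    have col0: "card {a. (a, b) \<in> Y0\<inverse>} = \<gamma> b" if "b < r" for b
    proof -
      have "{a. (a, b) \<in> Y0\<inverse>} = {..<\<gamma> b}" using that by (auto simp: Y0_def)
      then show ?thesis by simp
    qed
    have row0: "card {b. (a, b) \<in> Y0\<inverse>} = card {b. b < r \<and> a < \<gamma> b}" for a
      by (intro arg_cong[of _ _ card]) (auto simp: Y0_def)
    \<comment> \<open>No entry of \<open>\<mu>\<close> exceeds \<open>r\<close>, so truncation at
      \<open>r\<close> changes nothing and the totals agree.\<close>
    have sum_\<kappa>_r: "(\<Sum>b<r. \<kappa> b) = s"
      unfolding sum_\<kappa> \<mu>(2)[symmetric] using \<mu>_le by (intro sum.cong) auto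
    have "\<exists>Y. finite Y \<and> Y \<subseteq> {..<t} \<times> {..<r} \<and>
        (\<forall>a. card {b. (a, b) \<in> Y} = card {b. (a, b) \<in> Y0\<inverse>}) \<and>
        (\<forall>b<r. card {a. (a, b) \<in> Y} = \<kappa> b)"
    proof (rule gale_ryser_sufficient)
      show "finite (Y0\<inverse>)" by (simp add: Y0_def)
      show "Y0\<inverse> \<subseteq> {..<t} \<times> {..<r}" using \<gamma>_le by (force simp: Y0_def)
      show "\<kappa> k \<le> \<kappa> i" if "i \<le> k" for i k
        unfolding \<kappa>_def using that by (intro card_mono) auto
      show "(\<Sum>b<n. \<kappa> b) \<le> (\<Sum>b<n. card {a. (a, b) \<in> Y0\<inverse>})" if "n \<le> r" for n
        using dom that col0 by simp
      show "(\<Sum>b<r. \<kappa> b) = (\<Sum>b<r. card {a. (a, b) \<in> Y0\<inverse>})"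
        using col0 \<gamma>(2) sum_\<kappa>_r by simp
    qed
    then obtain Y where Y: "finite Y" "Y \<subseteq> {..<t} \<times> {..<r}"
      "\<And>a. card {b. (a, b) \<in> Y} = card {b. b < r \<and> a < \<gamma> b}"
      "\<And>b. b < r \<Longrightarrow> card {a. (a, b) \<in> Y} = \<kappa> b"
      using row0 by auto
    let ?pt = "affine_point :: nat \<Rightarrow> ('k \<times> 'k) set"
    define X where "X = map_prod ?pt ?pt ` Y"
    have inj: "inj ?pt" by (rule inj_affine_point)
    have X: "X \<subseteq> proj_line \<times> proj_line" "finite X"
      using Y(1) affine_point_in by (auto simp: X_def)
    have fin: "finite {a. (a, b) \<in> Y}" for b
      using finite_subset[of "{a. (a, b) \<in> Y}" "{..<t}"] Y(2) by auto
    have "(Sigma {..<r} (\<lambda>b. {a. (a, b) \<in> Y}))\<inverse> = Y"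
      using Y(2) by auto
    then have "card Y = card (Sigma {..<r} (\<lambda>b. {a. (a, b) \<in> Y}))"
      using card_inverse[of "Sigma {..<r} (\<lambda>b. {a. (a, b) \<in> Y})"] by (simp only:)
    also have "\<dots> = (\<Sum>b<r. card {a. (a, b) \<in> Y})"
      by (rule card_SigmaI) (simp_all add: fin)
    finally have "card Y = (\<Sum>b<r. card {a. (a, b) \<in> Y})" .
    then have "card Y = s" using Y(4) sum_\<kappa>_r by simp
    moreover have "card X = card Y"
      unfolding X_def using inj by (intro card_image inj_on_subset[OF prod.inj_map]) auto
    ultimately have card_X: "card X = s" by simp
    have row: "X `` {?pt a} = ?pt ` {b. (a, b) \<in> Y}" for a
      using inj by (auto simp: X_def inj_eq)
    have col: "X\<inverse> `` {?pt b} = ?pt ` {a. (a, b) \<in> Y}" for b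
      using inj by (auto simp: X_def inj_eq)
    have card_pt: "card (?pt ` A) = card A" for A
      using inj by (intro card_image) (auto intro: inj_on_subset)
    \<comment> \<open>From \<open>\<gamma> 0 = t\<close>, column 0 of the Ferrers diagram meets
      every row, and row sums are preserved. With \<open>\<mu> 0 = r\<close> giving the same for
      columns, the projections have exactly \<open>t\<close> and \<open>r\<close> points.\<close>
    have "0 < card {b. (a, b) \<in> Y}" if "a < t" for a
      using that assms(1) \<gamma>0 unfolding Y(3)
      by (auto simp: card_gt_0_iff intro!: exI[of _ 0])
    then have "\<exists>b. (a, b) \<in> Y" if "a < t" for a
      using that by (fastforce simp: card_gt_0_iff)
    then have "fst ` Y = {..<t}"
      using Y(2) by (auto simp: image_iff Bex_def)
    then have fst_X: "fst ` X = ?pt ` {..<t}"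
      unfolding X_def by (metis fst_comp_map_prod image_comp)
    have "0 < card {a. (a, b) \<in> Y}" if "b < r" for b
      using that assms(2) \<mu>0 unfolding Y(4)[OF that] \<kappa>_def
      by (auto simp: card_gt_0_iff intro!: exI[of _ 0])
    then have "\<exists>a. (a, b) \<in> Y" if "b < r" for b
      using that by (fastforce simp: card_gt_0_iff)
    then have "snd ` Y = {..<r}"
      using Y(2) by (auto simp: image_iff Bex_def)
    then have snd_X: "snd ` X = ?pt ` {..<r}"
      unfolding X_def by (metis snd_comp_map_prod image_comp)
    have "X \<noteq> {}" using fst_X assms(2) by (auto simp: lessThan_empty_iff)
    have filter_pt: "{P\<in>?pt ` A. R P} = ?pt ` {a\<in>A. R (?pt a)}" for A R by auto
    \<comment> \<open>The row sums are conjugate to \<open>\<gamma>\<close> and the difference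
      conjugates them once more, which returns \<open>\<gamma>\<close>. The row vector follows in
      the same way from \<open>\<kappa>\<close> and \<open>\<mu>\<close>.\<close>
    have "diff_tuple (eventual_column X) = diff_tuple B_C"
      unfolding diff_tuple_eventual_column[OF X \<open>X \<noteq> {}\<close>] \<gamma>(1) fst_X snd_X filter_pt row card_pt Y(3)
      using card_less_conjugate[of r \<gamma> _ t] \<gamma>(3) \<gamma>_le by simp
    moreover have "diff_tuple (eventual_row X) = diff_tuple B_R"
    proof -
      have "{b\<in>{..<r}. i < card {a. (a, b) \<in> Y}} =
          {b. b < r \<and> i < card {j. j < t \<and> b < \<mu> j}}" for i
        using Y(4) by (auto simp: \<kappa>_def)
      then show ?thesis
        unfolding diff_tuple_eventual_row[OF X \<open>X \<noteq> {}\<close>] \<mu>(1) fst_X snd_X filter_pt col card_pt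
        using card_less_conjugate[of t \<mu> _ r] \<mu>(3) \<mu>_le by simp
    qed
    ultimately show "\<exists>X :: 'k point set. X \<subseteq> proj_line \<times> proj_line \<and> finite X \<and> card X = s \<and>
            eventual_column X = B_C \<and> eventual_row X = B_R"
      using X card_X diff_tuple_inject by blast
  qed
qed

end
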